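(* Let $0<\alpha\le 2$ and $K>0$. For any $\varepsilon\in(0,1)$ there exist constants $C_1,C_2>0$ depending only on $\alpha$, $K$ and $\varepsilon$ such that, for all integers $n\ge 2$, $p\ge 1$ and $s\in[p]$, the test $$\phi_{\mathcal{G},\mathrm{dense}}:=\mathbf{1}\Bigl\{\max_{t\in\mathcal{T}}A_t>r\Bigr\}\quad\text{with}\quad r=C_1\bigl(\sqrt{p\log\log(8n)}+\log\log(8n)\bigr)$$ satisfies $\mathcal{R}_{\mathcal{G}}(\rho,\phi_{\mathcal{G},\mathrm{dense}})\le\varepsilon$ as long as $$\rho^2\ge C_2\bigl(\sqrt{p\log\log(8n)}+\log\log(8n)\bigr).$$
   Context: Notation: $[m]=\{1,\dots,m\}$; $\log$ is the natural logarithm; $\|v\|_0$ is the number of nonzero entries of $v$. Model: $X=\theta+E\in\mathbb{R}^{p\times n}$, with deterministic $\theta$ and random $E\sim P_e$; $X_t,\theta_t,E_t\in\mathbb{R}^p$ denote the $t$-th columns and $X_t(j)$ the $j$-th entry of $X_t$. $\mathbb{E}_{\theta,P_e}$ is expectation under the law of $X$. Null space: $\Theta_0(p,n)=\{\theta:\exists\mu\in\mathbb{R}^p,\ \theta_t=\mu\ \forall t\in[n]\}$. For $t_0\in[n-1]$, $\Theta^{(t_0)}(p,n,s,\rho)$ is the set of $\theta$ for which there are $\mu_1,\mu_2\in\mathbb{R}^p$ with $\theta_t=\mu_1$ for $t\le t_0$, $\theta_t=\mu_2$ for $t>t_0$, $\|\mu_1-\mu_2\|_0\le s$ and $\frac{t_0(n-t_0)}{n}\|\mu_1-\mu_2\|_2^2\ge\rho^2$.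 Alternative space: $\Theta(p,n,s,\rho)=\bigcup_{t_0=1}^{n-1}\Theta^{(t_0)}(p,n,s,\rho)$. Noise class: $\mathcal{G}_{\alpha,K}$ is the class of distributions of real random variables $W$ with $\mathbb{E}W=0$, $\mathbb{E}W^2=1$, $\mathbb{E}\exp(|W/K|^\alpha)\le 2$. $\mathcal{G}_{\alpha,K}^{\otimes}$ is the class of joint distributions of $E$ with mutually independent entries, each entry having a (possibly different) distribution in $\mathcal{G}_{\alpha,K}$. Worst-case testing error of a measurable test $\phi:\mathbb{R}^{p\times n}\to\{0,1\}$: $$\mathcal{R}_{\mathcal{G}}(\rho,\phi)=\sup_{P_e\in\mathcal{G}_{\alpha,K}^{\otimes}}\sup_{\theta\in\Theta_0(p,n)}\mathbb{E}_{\theta,P_e}(\phi)+\sup_{P_e\in\mathcal{G}_{\alpha,K}^{\otimes}}\sup_{\theta\in\Theta(p,n,s,\rho)}\mathbb{E}_{\theta,P_e}(1-\phi).$$ Test statistics: $\mathcal{T}=\{1,2,4,\dots,2^{\lfloor\log_2(n/2)\rfloor}\}$ and, for $t\in\mathcal{T}$, $$Y_t=\frac{\sum_{i=1}^tX_i-\sum_{i=1}^tX_{n+1-i}}{\sqrt{2t}}\in\mathbb{R}^p,\qquad A_t=\sum_{j=1}^p\{Y_t^2(j)-1\}.$$ *)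

theory Defs
  imports "HOL-Probability.Probability"
begin

text \<open>
  A real \<open>p \<times> n\<close> matrix \<open>X\<close> is an extensional function on \<open>{1..p} \<times> {1..n}\<close>: \<open>X (j, t)\<close> is the
  entry in row \<open>j\<close> and column \<open>t\<close>, that is, the \<open>j\<close>-th entry of the column \<open>X\<^sub>t\<close>.
  The dimensions are natural numbers rather than types because the constants in the main
  statement have to be uniform in \<open>p\<close> and \<open>n\<close>.  A vector in \<open>p\<close> dimensions is a function of
  type \<open>nat \<Rightarrow> real\<close>, of which only the values on \<open>{1..p}\<close> are ever used.
\<close>

definition mat_index :: "nat \<Rightarrow> nat \<Rightarrow> (nat \<times> nat) set" where
  "mat_index p n = {1..p} \<times> {1..n}"

definition mat_space :: "nat \<Rightarrow> nat \<Rightarrow> (nat \<times> nat \<Rightarrow> real) measure" where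
  "mat_space p n = Pi\<^sub>M (mat_index p n) (\<lambda>_. borel)"

definition mat_add ::
  "nat \<Rightarrow> nat \<Rightarrow> (nat \<times> nat \<Rightarrow> real) \<Rightarrow> (nat \<times> nat \<Rightarrow> real) \<Rightarrow> (nat \<times> nat \<Rightarrow> real)" where
  "mat_add p n \<theta> E = (\<lambda>i\<in>mat_index p n. \<theta> i + E i)"

definition l0_norm :: "nat \<Rightarrow> (nat \<Rightarrow> real) \<Rightarrow> nat" where
  "l0_norm p v = card {j \<in> {1..p}. v j \<noteq> 0}"

definition null_params :: "nat \<Rightarrow> nat \<Rightarrow> (nat \<times> nat \<Rightarrow> real) set" where
  "null_params p n =
     {\<theta> \<in> mat_index p n \<rightarrow>\<^sub>E UNIV. \<exists>\<mu>. \<forall>t\<in>{1..n}. \<forall>j\<in>{1..p}. \<theta> (j, t) = \<mu> j}"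

definition alt_params_at ::
  "nat \<Rightarrow> nat \<Rightarrow> nat \<Rightarrow> real \<Rightarrow> nat \<Rightarrow> (nat \<times> nat \<Rightarrow> real) set" where
  "alt_params_at p n s \<rho> t\<^sub>0 =
     {\<theta> \<in> mat_index p n \<rightarrow>\<^sub>E UNIV. \<exists>\<mu>\<^sub>1 \<mu>\<^sub>2.
        (\<forall>t\<in>{1..n}. \<forall>j\<in>{1..p}. \<theta> (j, t) = (if t \<le> t\<^sub>0 then \<mu>\<^sub>1 j else \<mu>\<^sub>2 j)) \<and>
        l0_norm p (\<lambda>j. \<mu>\<^sub>1 j - \<mu>\<^sub>2 j) \<le> s \<and>
        real t\<^sub>0 * (real n - real t\<^sub>0) / real n * (L2_set (\<lambda>j. \<mu>\<^sub>1 j - \<mu>\<^sub>2 j) {1..p})\<^sup>2 \<ge> \<rho>\<^sup>2}"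

definition alt_params :: "nat \<Rightarrow> nat \<Rightarrow> nat \<Rightarrow> real \<Rightarrow> (nat \<times> nat \<Rightarrow> real) set" where
  "alt_params p n s \<rho> = (\<Union>t\<^sub>0\<in>{1..n - 1}. alt_params_at p n s \<rho> t\<^sub>0)"

text \<open>
  The exponential moment is taken in \<open>[0, \<infinity>]\<close>, so that the bound includes its finiteness.
  Integrability of the square follows from its Bochner integral being nonzero.
\<close>

definition noise_class :: "real \<Rightarrow> real \<Rightarrow> real measure set" where
  "noise_class \<alpha> K =
     {D. real_distribution D \<and>
         integrable D (\<lambda>w. w) \<and> (LINT w|D. w) = 0 \<and>
         (LINT w|D. w\<^sup>2) = 1 \<and>
         (\<integral>\<^sup>+w. ennreal (exp (\<bar>w / K\<bar> powr \<alpha>)) \<partial>D) \<le> 2}"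

definition joint_noise_class ::
  "real \<Rightarrow> real \<Rightarrow> nat \<Rightarrow> nat \<Rightarrow> (nat \<times> nat \<Rightarrow> real) measure set" where
  "joint_noise_class \<alpha> K p n =
     {P. prob_space P \<and> sets P = sets (mat_space p n) \<and>
         prob_space.indep_vars P (\<lambda>_. borel) (\<lambda>i E. E i) (mat_index p n) \<and>
         (\<forall>i\<in>mat_index p n. distr P borel (\<lambda>E. E i) \<in> noise_class \<alpha> K)}"

definition data_law ::
  "nat \<Rightarrow> nat \<Rightarrow> (nat \<times> nat \<Rightarrow> real) \<Rightarrow> (nat \<times> nat \<Rightarrow> real) measure
    \<Rightarrow> (nat \<times> nat \<Rightarrow> real) measure" where
  "data_law p n \<theta> P = distr P (mat_space p n) (mat_add p n \<theta>)"

text \<open>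
  A test is a measurable function on \<open>mat_space p n\<close> with values in \<open>{0, 1}\<close>.  Suprema are taken
  in \<open>ennreal\<close>, so a supremum over an empty set of distributions (which occurs for small \<open>K\<close>)
  is \<open>0\<close>.
\<close>

definition worst_case_error ::
  "real \<Rightarrow> real \<Rightarrow> nat \<Rightarrow> nat \<Rightarrow> nat \<Rightarrow> real \<Rightarrow> ((nat \<times> nat \<Rightarrow> real) \<Rightarrow> real) \<Rightarrow> ennreal" where
  "worst_case_error \<alpha> K p n s \<rho> \<phi> =
     (SUP P\<in>joint_noise_class \<alpha> K p n. SUP \<theta>\<in>null_params p n.
        \<integral>\<^sup>+X. ennreal (\<phi> X) \<partial>data_law p n \<theta> P) +
     (SUP P\<in>joint_noise_class \<alpha> K p n. SUP \<theta>\<in>alt_params p n s \<rho>.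
        \<integral>\<^sup>+X. ennreal (1 - \<phi> X) \<partial>data_law p n \<theta> P)"

definition dyadic_grid :: "nat \<Rightarrow> nat set" where
  "dyadic_grid n = (\<lambda>k. 2 ^ k) ` {0..nat \<lfloor>log 2 (real n / 2)\<rfloor>}"

definition Y_stat :: "nat \<Rightarrow> (nat \<times> nat \<Rightarrow> real) \<Rightarrow> nat \<Rightarrow> nat \<Rightarrow> real" where
  "Y_stat n X t j =
     ((\<Sum>i=1..t. X (j, i)) - (\<Sum>i=1..t. X (j, n + 1 - i))) / sqrt (2 * real t)"

definition A_stat :: "nat \<Rightarrow> nat \<Rightarrow> (nat \<times> nat \<Rightarrow> real) \<Rightarrow> nat \<Rightarrow> real" where
  "A_stat p n X t = (\<Sum>j=1..p. ((Y_stat n X t j)\<^sup>2 - 1))"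

definition dense_rate :: "nat \<Rightarrow> nat \<Rightarrow> real" where
  "dense_rate p n = sqrt (real p * ln (ln (8 * real n))) + ln (ln (8 * real n))"

definition dense_test :: "nat \<Rightarrow> nat \<Rightarrow> real \<Rightarrow> (nat \<times> nat \<Rightarrow> real) \<Rightarrow> real" where
  "dense_test p n r X = of_bool (Max (A_stat p n X ` dyadic_grid n) > r)"

lemma measurable_mat_add: "mat_add p n \<theta> \<in> mat_space p n \<rightarrow>\<^sub>M mat_space p n"
  unfolding mat_add_def mat_space_def by measurable

lemma finite_dyadic_grid: "finite (dyadic_grid n)"
  and dyadic_grid_nonempty: "dyadic_grid n \<noteq> {}"
  by (auto simp: dyadic_grid_def)

lemma dyadic_grid_bounds:
  assumes "n \<ge> 2" "t \<in> dyadic_grid n"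
  shows "1 \<le> t" "2 * t \<le> n"
proof -
  obtain k where k: "t = 2 ^ k" "k \<le> nat \<lfloor>log 2 (real n / 2)\<rfloor>"
    using assms(2) by (auto simp: dyadic_grid_def)
  have "log 2 (real n / 2) \<ge> 0"
    using assms(1) by simp
  then have "real k \<le> log 2 (real n / 2)"
    using k(2) by linarith
  then have "2 powr real k \<le> real n / 2"
    using assms(1) by (simp add: le_log_iff)
  then have "real (2 * t) \<le> real n"
    by (simp add: k(1) powr_realpow)
  then show "2 * t \<le> n"
    by linarith
  show "1 \<le> t"
    by (simp add: k(1))
qed

lemma measurable_A_stat:
  assumes "n \<ge> 2" "t \<in> dyadic_grid n"
  shows "(\<lambda>X. A_stat p n X t) \<in> borel_measurable (mat_space p n)"
proof -
  have m: "(\<lambda>X. X (j, i)) \<in> borel_measurable (mat_space p n)"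
    if "j \<in> {1..p}" "i \<in> {1..n}" for i j
    using that unfolding mat_space_def
    by (intro measurable_component_singleton) (simp add: mat_index_def)
  show ?thesis
    using dyadic_grid_bounds[OF assms] unfolding A_stat_def Y_stat_def
    by (intro borel_measurable_sum borel_measurable_diff borel_measurable_power
        borel_measurable_divide borel_measurable_const m) auto
qed

lemma measurable_dense_test:
  assumes "n \<ge> 2"
  shows "dense_test p n r \<in> borel_measurable (mat_space p n)"
proof -
  have "{X \<in> space (mat_space p n). r < Max (A_stat p n X ` dyadic_grid n)} =
      (\<Union>t\<in>dyadic_grid n. {X \<in> space (mat_space p n). r < A_stat p n X t})"
    by (auto simp: Max_gr_iff finite_dyadic_grid dyadic_grid_nonempty)
  also have "\<dots> \<in> sets (mat_space p n)"
    using measurable_A_stat[OF assms]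
    by (intro sets.finite_UN finite_dyadic_grid) (auto simp: borel_measurable_iff_greater)
  finally have "Measurable.pred (mat_space p n) (\<lambda>X. r < Max (A_stat p n X ` dyadic_grid n))"
    by (simp add: pred_def)
  then show ?thesis
    unfolding dense_test_def by measurable
qed

end

theory Submission
  imports Defs
begin

text \<open>
  The noise enters only through a uniform bound on the sixth moment. Fix a scale \<open>t\<close> and a row \<open>j\<close>, put
  \<open>m = 2 t\<close>, write \<open>Y = S / sqrt m\<close> for the contrast \<open>Y\<^sub>t(j)\<close> of the noise and \<open>Q\<close> for the sum of
  squares of its \<open>m\<close> entries. Since \<open>exp (y - y\<^sup>2) \<le> 1 + y + y\<^sup>2\<close>, the self-normalized process satisfies
  \<open>E exp (s S - s\<^sup>2 Q) \<le> exp (m s\<^sup>2)\<close>, and averaging over a Gaussian \<open>s\<close> shows that \<open>exp (Y\<^sup>2 / 24)\<close> has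
  bounded expectation on the regular event \<open>Q \<le> 2 m\<close>. On its complement, whose probability is \<open>O(1 / m)\<close>,
  the sixth moment of \<open>Y\<close> bounds the second moment of \<open>Y\<^sup>2 - 1\<close> by \<open>O((8 / 9)\<^sup>k)\<close> for \<open>t = 2\<^sup>k\<close>.

  Thus \<open>A\<^sub>t\<close> splits into a sum of independent subexponential variables, whose deviations of order
  \<open>C\<^sub>1 (sqrt (p log log 8n) + log log 8n)\<close> are rarer than a large power of \<open>1 / log (8n)\<close>, and a sum whose
  deviations have, by Chebyshev, probabilities summable over the dyadic scales. A union bound
  controls the first kind of error. For the second, the scale \<open>t\<close> with
  \<open>t \<le> min t\<^sub>0 (n - t\<^sub>0) < 2 t\<close> carries at least a quarter of the signal, and Chebyshev suffices.
\<close>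

section \<open>Sums of independent centered variables\<close>

text \<open>The difference \<open>g\<close> of the logarithms of the two sides vanishes at 0, and
  its derivative has the sign of the argument, so 0 is its minimum. The right side has a finite mean
  as soon as a second moment exists, whatever the tails.\<close>

lemma exp_diff_square_le:
  fixes y :: real
  shows "exp (y - y\<^sup>2) \<le> 1 + y + y\<^sup>2"
proof -
  have pos: "0 < 1 + u + u\<^sup>2" for u :: real
  proof -
    have "1 + u + u\<^sup>2 = (u + 1/2)\<^sup>2 + 3/4"
      by (simp add: power2_eq_square algebra_simps)
    then show ?thesis
      by (smt (verit) zero_le_power2 divide_pos_pos)
  qed
  define g where "g u = ln (1 + u + u\<^sup>2) - u + u\<^sup>2" for u :: real
  have der: "(g has_real_derivative u * (3 + u + 2 * u\<^sup>2) / (1 + u + u\<^sup>2)) (at u)" for u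
  proof -
    have "(g has_real_derivative (1 + 2 * u) / (1 + u + u\<^sup>2) - 1 + 2 * u) (at u)"
      unfolding g_def using pos[of u] by (auto intro!: derivative_eq_intros)
    moreover have "(1 + 2 * u) / (1 + u + u\<^sup>2) - 1 + 2 * u =
        u * (3 + u + 2 * u\<^sup>2) / (1 + u + u\<^sup>2)"
      using pos[of u] by (simp add: field_simps power2_eq_square)
    ultimately show ?thesis by simp
  qed
  have pos': "0 < 3 + u + 2 * u\<^sup>2" for u :: real
    using pos[of u] zero_le_power2[of u] by linarith
  have "0 \<le> g y"
  proof (cases "0 \<le> y")
    case True
    have "g 0 \<le> g y"
    proof (rule DERIV_nonneg_imp_nondecreasing[OF True])
      fix x :: real assume "0 \<le> x" "x \<le> y"
      then show "\<exists>d. (g has_real_derivative d) (at x) \<and> 0 \<le> d"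
        using der[of x] pos[of x] pos'[of x] by (meson divide_nonneg_pos less_imp_le mult_nonneg_nonneg)
    qed
    then show ?thesis by (simp add: g_def)
  next
    case False
    then have y: "y \<le> 0" by simp
    have "g 0 \<le> g y"
    proof (rule DERIV_nonpos_imp_nonincreasing[OF y])
      fix x :: real assume "y \<le> x" "x \<le> 0"
      then show "\<exists>d. (g has_real_derivative d) (at x) \<and> d \<le> 0"
        using der[of x] pos[of x] pos'[of x] by (meson divide_nonpos_pos less_imp_le mult_nonpos_nonneg)
    qed
    then show ?thesis by (simp add: g_def)
  qed
  then have "y - y\<^sup>2 \<le> ln (1 + y + y\<^sup>2)"
    by (simp add: g_def)
  then show ?thesis
    using pos[of y] by (metis exp_le_cancel_iff exp_ln)
qed

text \<open>Beyond the linear term every power of \<open>\<theta>\<close> is at most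
  \<open>\<theta>\<^sup>2\<close>. Comparing the exponential series term by term leaves an error
  quadratic in \<open>\<theta>\<close>, paid for by one exponential of the unscaled
  argument.\<close>

lemma exp_scaled_le:
  fixes x \<theta> :: real
  assumes "0 \<le> \<theta>" "\<theta> \<le> 1"
  shows "exp (\<theta> * x) \<le> 1 + \<theta> * x + \<theta>\<^sup>2 * exp \<bar>x\<bar>"
proof -
  have s: "summable (\<lambda>n. inverse (fact (n + 2)) * y ^ (n + 2))" for y :: real
    using summable_exp_generic[of y] summable_ignore_initial_segment[of "\<lambda>n. inverse (fact n) * y ^ n" 2]
    by (simp add: scaleR_conv_of_real summable_exp)
  have "(\<Sum>n. inverse (fact (n + 2)) * (\<theta> * x) ^ (n + 2)) \<le>
      (\<Sum>n. \<theta>\<^sup>2 * (inverse (fact (n + 2)) * \<bar>x\<bar> ^ (n + 2)))"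
  proof (intro suminf_le summable_mult s)
    fix n :: nat
    have "(\<theta> * x) ^ (n + 2) \<le> \<bar>\<theta> * x\<bar> ^ (n + 2)"
      by (metis abs_ge_self power_abs)
    also have "\<dots> = \<theta> ^ n * (\<theta>\<^sup>2 * \<bar>x\<bar> ^ (n + 2))"
      using assms by (simp add: abs_mult power_mult_distrib power_add power2_eq_square)
    also have "\<dots> \<le> 1 * (\<theta>\<^sup>2 * \<bar>x\<bar> ^ (n + 2))"
      using assms by (intro mult_right_mono power_le_one) auto
    finally show "inverse (fact (n + 2)) * (\<theta> * x) ^ (n + 2) \<le>
        \<theta>\<^sup>2 * (inverse (fact (n + 2)) * \<bar>x\<bar> ^ (n + 2))"
      by (simp add: mult.left_commute mult_left_mono del: fact_Suc power_Suc)
  qed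
  also have "\<dots> = \<theta>\<^sup>2 * (\<Sum>n. inverse (fact (n + 2)) * \<bar>x\<bar> ^ (n + 2))"
    by (rule suminf_mult[OF s])
  also have "\<dots> \<le> \<theta>\<^sup>2 * exp \<bar>x\<bar>"
    using exp_first_two_terms[of "\<bar>x\<bar>"] by (intro mult_left_mono) auto
  finally show ?thesis
    using exp_first_two_terms[of "\<theta> * x"] by simp
qed

lemma (in prob_space) indep_vars_sum_square:
  fixes X :: "'i \<Rightarrow> 'a \<Rightarrow> real"
  assumes "finite I" "indep_vars (\<lambda>_. borel) X I"
    and "\<And>i. i \<in> I \<Longrightarrow> integrable M (\<lambda>\<omega>. (X i \<omega>)\<^sup>2)"
    and "\<And>i. i \<in> I \<Longrightarrow> expectation (X i) = 0"
  shows integrable_indep_vars_sum_square: "integrable M (\<lambda>\<omega>. (\<Sum>i\<in>I. X i \<omega>)\<^sup>2)"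
    and expectation_indep_vars_sum_square:
      "expectation (\<lambda>\<omega>. (\<Sum>i\<in>I. X i \<omega>)\<^sup>2) = (\<Sum>i\<in>I. expectation (\<lambda>\<omega>. (X i \<omega>)\<^sup>2))"
proof -
  have "integrable M (\<lambda>\<omega>. (\<Sum>i\<in>I. X i \<omega>)\<^sup>2) \<and>
      expectation (\<lambda>\<omega>. (\<Sum>i\<in>I. X i \<omega>)\<^sup>2) = (\<Sum>i\<in>I. expectation (\<lambda>\<omega>. (X i \<omega>)\<^sup>2))"
    using assms
  proof (induction I rule: finite_induct)
    case empty
    then show ?case by simp
  next
    case (insert i I)
    let ?S = "\<lambda>\<omega>. \<Sum>i\<in>I. X i \<omega>"
    have rv: "random_variable borel (X j)" if "j \<in> insert i I" for j
      using insert.prems(1) that by (auto simp: indep_vars_def)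
    have IH: "integrable M (\<lambda>\<omega>. (?S \<omega>)\<^sup>2)"
        "expectation (\<lambda>\<omega>. (?S \<omega>)\<^sup>2) = (\<Sum>i\<in>I. expectation (\<lambda>\<omega>. (X i \<omega>)\<^sup>2))"
      using insert.IH insert.prems indep_vars_subset[OF insert.prems(1), of I] by auto
    have int: "integrable M (X j)" if "j \<in> insert i I" for j
      by (rule square_integrable_imp_integrable[OF rv[OF that]]) (use insert.prems that in auto)
    have intS: "integrable M ?S"
      using int by (intro Bochner_Integration.integrable_sum) auto
    have ind: "indep_var borel (X i) borel ?S"
      by (rule indep_vars_sum) (use insert in auto)
    have intXS: "integrable M (\<lambda>\<omega>. X i \<omega> * ?S \<omega>)"
      by (rule indep_var_integrable[OF ind]) (use int intS in auto)
    have "expectation (\<lambda>\<omega>. X i \<omega> * ?S \<omega>) = expectation (X i) * expectation ?S"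
      by (rule indep_var_lebesgue_integral[OF ind]) (use int intS in auto)
    then have EXS: "expectation (\<lambda>\<omega>. X i \<omega> * ?S \<omega>) = 0"
      using insert.prems(3) by simp
    have eq: "(\<lambda>\<omega>. (\<Sum>i\<in>insert i I. X i \<omega>)\<^sup>2) =
        (\<lambda>\<omega>. (X i \<omega>)\<^sup>2 + 2 * (X i \<omega> * ?S \<omega>) + (?S \<omega>)\<^sup>2)"
      using insert.hyps by (auto simp: power2_eq_square algebra_simps)
    show ?case
      unfolding eq using IH intXS insert.prems(2)[of i] EXS insert.hyps by simp
  qed
  then show "integrable M (\<lambda>\<omega>. (\<Sum>i\<in>I. X i \<omega>)\<^sup>2)"
    and "expectation (\<lambda>\<omega>. (\<Sum>i\<in>I. X i \<omega>)\<^sup>2) = (\<Sum>i\<in>I. expectation (\<lambda>\<omega>. (X i \<omega>)\<^sup>2))"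
    by auto
qed

text \<open>Chebyshev's inequality; independence and centering remove the mixed terms of the second
  moment.\<close>

lemma (in prob_space) prob_abs_sum_ge:
  fixes X :: "'i \<Rightarrow> 'a \<Rightarrow> real"
  assumes "finite I" "indep_vars (\<lambda>_. borel) X I"
    and "\<And>i. i \<in> I \<Longrightarrow> integrable M (\<lambda>\<omega>. (X i \<omega>)\<^sup>2)"
    and "\<And>i. i \<in> I \<Longrightarrow> expectation (X i) = 0"
    and "\<And>i. i \<in> I \<Longrightarrow> expectation (\<lambda>\<omega>. (X i \<omega>)\<^sup>2) \<le> V i"
    and "0 < r"
  shows "prob {\<omega> \<in> space M. r \<le> \<bar>\<Sum>i\<in>I. X i \<omega>\<bar>} \<le> (\<Sum>i\<in>I. V i) / r\<^sup>2"
proof -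
  have "{\<omega> \<in> space M. r \<le> \<bar>\<Sum>i\<in>I. X i \<omega>\<bar>} = {\<omega> \<in> space M. r\<^sup>2 \<le> (\<Sum>i\<in>I. X i \<omega>)\<^sup>2}"
    using \<open>0 < r\<close> by (auto simp: abs_le_square_iff[symmetric])
  also have "prob \<dots> \<le> expectation (\<lambda>\<omega>. (\<Sum>i\<in>I. X i \<omega>)\<^sup>2) / r\<^sup>2"
    using assms by (intro integral_Markov_inequality_measure[where A="{}"] integrable_indep_vars_sum_square) auto
  also have "\<dots> \<le> (\<Sum>i\<in>I. V i) / r\<^sup>2"
    using assms by (subst expectation_indep_vars_sum_square) (auto intro!: divide_right_mono sum_mono)
  finally show ?thesis .
qed

text \<open>Chernoff's method for subexponential summands: by \<open>exp_scaled_le\<close> with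
  \<open>\<theta> = \<kappa> / c\<close> and by centering, each moment generating function at
  \<open>\<kappa>\<close> is at most \<open>exp (B * \<theta>\<^sup>2)\<close>, and independence
  multiplies these bounds.\<close>

lemma (in prob_space) prob_sum_ge_exp:
  fixes X :: "'i \<Rightarrow> 'a \<Rightarrow> real"
  assumes "finite I" and ind: "indep_vars (\<lambda>_. borel) X I"
    and int: "\<And>i. i \<in> I \<Longrightarrow> integrable M (X i)"
    and mean: "\<And>i. i \<in> I \<Longrightarrow> expectation (X i) = 0"
    and inte: "\<And>i. i \<in> I \<Longrightarrow> integrable M (\<lambda>\<omega>. exp (c * \<bar>X i \<omega>\<bar>))"
    and B: "\<And>i. i \<in> I \<Longrightarrow> expectation (\<lambda>\<omega>. exp (c * \<bar>X i \<omega>\<bar>)) \<le> B"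
    and c: "0 < \<kappa>" "\<kappa> \<le> c"
  shows "prob {\<omega> \<in> space M. r \<le> (\<Sum>i\<in>I. X i \<omega>)} \<le> exp (real (card I) * B * (\<kappa> / c)\<^sup>2 - \<kappa> * r)"
proof -
  have rv [measurable]: "random_variable borel (X i)" if "i \<in> I" for i
    using int that by auto
  define \<theta> where "\<theta> = \<kappa> / c"
  have \<theta>: "0 \<le> \<theta>" "\<theta> \<le> 1"
    using c by (auto simp: \<theta>_def)
  have pt: "exp (\<kappa> * x) \<le> 1 + \<kappa> * x + \<theta>\<^sup>2 * exp (c * \<bar>x\<bar>)" for x
    using exp_scaled_le[OF \<theta>, of "c * x"] c by (simp add: \<theta>_def abs_mult)
  have inte': "integrable M (\<lambda>\<omega>. exp (\<kappa> * X i \<omega>))" if "i \<in> I" for i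
  proof (rule Bochner_Integration.integrable_bound)
    show "integrable M (\<lambda>\<omega>. 1 + \<kappa> * X i \<omega> + \<theta>\<^sup>2 * exp (c * \<bar>X i \<omega>\<bar>))"
      using int inte that by auto
    show "random_variable borel (\<lambda>\<omega>. exp (\<kappa> * X i \<omega>))"
      using that by measurable
  next
    have "norm (exp (\<kappa> * X i \<omega>)) \<le> norm (1 + \<kappa> * X i \<omega> + \<theta>\<^sup>2 * exp (c * \<bar>X i \<omega>\<bar>))" for \<omega>
      using pt[of "X i \<omega>"] by simp
    then show "AE \<omega> in M. norm (exp (\<kappa> * X i \<omega>)) \<le> norm (1 + \<kappa> * X i \<omega> + \<theta>\<^sup>2 * exp (c * \<bar>X i \<omega>\<bar>))"
      by simp
  qed
  have mgf: "expectation (\<lambda>\<omega>. exp (\<kappa> * X i \<omega>)) \<le> exp (B * \<theta>\<^sup>2)" if "i \<in> I" for i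
  proof -
    have "expectation (\<lambda>\<omega>. exp (\<kappa> * X i \<omega>)) \<le>
        expectation (\<lambda>\<omega>. 1 + \<kappa> * X i \<omega> + \<theta>\<^sup>2 * exp (c * \<bar>X i \<omega>\<bar>))"
      using inte' int inte that pt by (intro integral_mono) auto
    also have "\<dots> = 1 + \<theta>\<^sup>2 * expectation (\<lambda>\<omega>. exp (c * \<bar>X i \<omega>\<bar>))"
      using int inte mean that by (simp add: prob_space)
    also have "\<dots> \<le> 1 + B * \<theta>\<^sup>2"
      using mult_left_mono[OF B[OF that], of "\<theta>\<^sup>2"] by (simp add: mult.commute)
    also have "\<dots> \<le> exp (B * \<theta>\<^sup>2)"
      by (rule exp_ge_add_one_self)
    finally show ?thesis .
  qed
  have ind': "indep_vars (\<lambda>_. borel) (\<lambda>i \<omega>. exp (\<kappa> * X i \<omega>)) I"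
    by (rule indep_vars_compose2[OF ind]) simp
  have eq: "(\<lambda>\<omega>. exp (\<kappa> * (\<Sum>i\<in>I. X i \<omega>))) = (\<lambda>\<omega>. \<Prod>i\<in>I. exp (\<kappa> * X i \<omega>))"
    using \<open>finite I\<close> by (simp add: sum_distrib_left exp_sum)
  have intS: "integrable M (\<lambda>\<omega>. exp (\<kappa> * (\<Sum>i\<in>I. X i \<omega>)))"
    unfolding eq using \<open>finite I\<close> ind' inte' by (intro indep_vars_integrable) auto
  have "{\<omega> \<in> space M. r \<le> (\<Sum>i\<in>I. X i \<omega>)} =
      {\<omega> \<in> space M. exp (\<kappa> * r) \<le> exp (\<kappa> * (\<Sum>i\<in>I. X i \<omega>))}"
    using c by auto
  also have "prob \<dots> \<le> expectation (\<lambda>\<omega>. exp (\<kappa> * (\<Sum>i\<in>I. X i \<omega>))) / exp (\<kappa> * r)"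
    by (intro integral_Markov_inequality_measure[where A="{}"] intS) auto
  also have "\<dots> = (\<Prod>i\<in>I. expectation (\<lambda>\<omega>. exp (\<kappa> * X i \<omega>))) / exp (\<kappa> * r)"
    unfolding eq using \<open>finite I\<close> ind' inte' by (subst indep_vars_lebesgue_integral) auto
  also have "\<dots> \<le> (\<Prod>i\<in>I. exp (B * \<theta>\<^sup>2)) / exp (\<kappa> * r)"
    using mgf by (intro divide_right_mono prod_mono) (auto intro!: integral_nonneg)
  also have "\<dots> = exp (real (card I) * B * (\<kappa> / c)\<^sup>2 - \<kappa> * r)"
    by (simp add: \<theta>_def exp_diff exp_of_nat_mult[symmetric] mult.assoc)
  finally show ?thesis .
qed

section \<open>Moments of self-normalized sums\<close>

lemma nn_integral_exp_normal_density:
  assumes "0 < \<sigma>"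
  shows "(\<integral>\<^sup>+u. ennreal (exp (u * y) * normal_density 0 \<sigma> u) \<partial>lborel) = ennreal (exp (\<sigma>\<^sup>2 * y\<^sup>2 / 2))"
proof -
  have "exp (u * y) * normal_density 0 \<sigma> u = exp (\<sigma>\<^sup>2 * y\<^sup>2 / 2) * normal_density (\<sigma>\<^sup>2 * y) \<sigma> u" for u
  proof -
    have "u * y + - (u\<^sup>2 / (2 * \<sigma>\<^sup>2)) = \<sigma>\<^sup>2 * y\<^sup>2 / 2 + - ((u - \<sigma>\<^sup>2 * y)\<^sup>2 / (2 * \<sigma>\<^sup>2))"
      using assms by (simp add: field_simps power2_eq_square)
    then show ?thesis
      by (simp add: normal_density_def mult_exp_exp)
  qed
  then have "(\<integral>\<^sup>+u. ennreal (exp (u * y) * normal_density 0 \<sigma> u) \<partial>lborel) =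
      ennreal (exp (\<sigma>\<^sup>2 * y\<^sup>2 / 2)) * (\<integral>\<^sup>+u. ennreal (normal_density (\<sigma>\<^sup>2 * y) \<sigma> u) \<partial>lborel)"
    by (simp add: ennreal_mult nn_integral_cmult)
  also have "(\<integral>\<^sup>+u. ennreal (normal_density (\<sigma>\<^sup>2 * y) \<sigma> u) \<partial>lborel) = 1"
    using assms by (simp add: nn_integral_eq_integral)
  finally show ?thesis by simp
qed

text \<open>The density of variance 1/12 has exponent \<open>- (6 * u\<^sup>2)\<close>. Adding
  \<open>3 * u\<^sup>2\<close> leaves the exponent of variance 1/6, and \<open>sqrt 2\<close> is the
  quotient of the normalizing constants.\<close>

lemma nn_integral_exp_square_normal_density:
  "(\<integral>\<^sup>+u. ennreal (exp (3 * u\<^sup>2) * normal_density 0 (sqrt (1 / 12)) u) \<partial>lborel) = ennreal (sqrt 2)"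
proof -
  have "exp (3 * u\<^sup>2) * normal_density 0 (sqrt (1 / 12)) u = sqrt 2 * normal_density 0 (sqrt (1 / 6)) u" for u
  proof -
    have "exp (3 * u\<^sup>2) * exp (- (6 * u\<^sup>2)) = exp (- (3 * u\<^sup>2))"
      by (simp add: mult_exp_exp)
    moreover have "sqrt (pi / 3) = sqrt 2 * sqrt (pi / 6)"
      by (simp add: real_sqrt_mult[symmetric])
    ultimately show ?thesis
      by (simp add: normal_density_def field_simps)
  qed
  then have "(\<integral>\<^sup>+u. ennreal (exp (3 * u\<^sup>2) * normal_density 0 (sqrt (1 / 12)) u) \<partial>lborel) =
      ennreal (sqrt 2) * (\<integral>\<^sup>+u. ennreal (normal_density 0 (sqrt (1 / 6)) u) \<partial>lborel)"
    by (simp add: ennreal_mult nn_integral_cmult)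
  also have "(\<integral>\<^sup>+u. ennreal (normal_density 0 (sqrt (1 / 6)) u) \<partial>lborel) = 1"
    by (simp add: nn_integral_eq_integral)
  finally show ?thesis by simp
qed

section \<open>Elementary inequalities between powers\<close>

lemma abs_power_le_one_plus:
  fixes x :: real
  assumes "k \<le> n"
  shows "\<bar>x ^ k\<bar> \<le> 1 + \<bar>x ^ n\<bar>"
proof (cases "\<bar>x\<bar> \<le> 1")
  case True
  then have "\<bar>x ^ k\<bar> \<le> 1"
    by (simp add: power_abs power_le_one)
  then show ?thesis by (smt (verit) abs_ge_zero)
next
  case False
  then show ?thesis
    using power_increasing[OF assms, of "\<bar>x\<bar>"] unfolding power_abs by linarith
qed

lemma (in finite_measure) integrable_power_le:
  fixes f :: "'a \<Rightarrow> real"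
  assumes [measurable]: "f \<in> borel_measurable M" and int: "integrable M (\<lambda>\<omega>. f \<omega> ^ n)" and "k \<le> n"
  shows "integrable M (\<lambda>\<omega>. f \<omega> ^ k)"
proof (rule Bochner_Integration.integrable_bound)
  show "integrable M (\<lambda>\<omega>. 1 + \<bar>f \<omega> ^ n\<bar>)"
    using int by auto
  show "AE \<omega> in M. norm (f \<omega> ^ k) \<le> norm (1 + \<bar>f \<omega> ^ n\<bar>)"
    using abs_power_le_one_plus[OF \<open>k \<le> n\<close>] by (auto simp: abs_of_nonneg)
qed measurable

text \<open>The binomial term linear in \<open>x\<close> is kept because it will have mean zero.
  AM-GM moves all later terms to \<open>x ^ 2 * s ^ 4\<close> and \<open>x ^ 6\<close>, so that only
  the second and sixth moments of \<open>x\<close> enter; 39 = 15 + 10 + 14 is the coefficient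
  collected by \<open>x ^ 2 * s ^ 4\<close>.\<close>

lemma sixth_power_add_le:
  fixes s x :: real
  shows "(s + x) ^ 6 \<le> s ^ 6 + 6 * (x * s ^ 5) + 39 * (x ^ 2 * s ^ 4 + x ^ 6)"
proof -
  have am_gm: "2 * (u * v) \<le> u\<^sup>2 + v\<^sup>2" for u v :: real
    using sum_squares_bound[of u v] by simp
  have 1: "2 * (s ^ 3 * x ^ 3) \<le> s ^ 4 * x ^ 2 + s ^ 2 * x ^ 4"
    using am_gm[of "s ^ 2 * x" "s * x ^ 2"]
    by (simp add: power2_eq_square eval_nat_numeral algebra_simps)
  have 2: "2 * (s ^ 2 * x ^ 4) \<le> s ^ 4 * x ^ 2 + x ^ 6"
    using am_gm[of "s ^ 2 * x" "x ^ 3"]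
    by (simp add: power2_eq_square eval_nat_numeral algebra_simps)
  have 3: "2 * (s * x ^ 5) \<le> s ^ 2 * x ^ 4 + x ^ 6"
    using am_gm[of "s * x ^ 2" "x ^ 3"]
    by (simp add: power2_eq_square eval_nat_numeral algebra_simps)
  have "(s + x) ^ 6 = s ^ 6 + 6 * (x * s ^ 5) + 15 * (s ^ 4 * x ^ 2) + 20 * (s ^ 3 * x ^ 3)
      + 15 * (s ^ 2 * x ^ 4) + 6 * (s * x ^ 5) + x ^ 6"
    by (simp add: eval_nat_numeral algebra_simps)
  moreover have "0 \<le> x ^ 6" "x ^ 2 * s ^ 4 = s ^ 4 * x ^ 2"
    by simp_all
  ultimately show ?thesis
    using 1 2 3 by argo
qed

text \<open>Below the level \<open>s\<^sup>2 = N\<close> the second summand dominates, above it the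
  first. A sixth moment thereby controls a fourth one with a freely chosen weight.\<close>

lemma fourth_power_le:
  fixes s N :: real
  assumes "0 < N"
  shows "s ^ 4 \<le> s ^ 6 / N + N\<^sup>2"
proof (cases "s\<^sup>2 \<le> N")
  case True
  then have "s ^ 4 \<le> N\<^sup>2"
    using power_mono[of "s\<^sup>2" N 2] by simp
  then show ?thesis
    using assms by (smt (verit) divide_nonneg_pos zero_le_even_power' even_numeral zero_le_even_power)
next
  case False
  have "s ^ 4 * N \<le> s ^ 4 * s\<^sup>2"
    using False by (intro mult_left_mono) auto
  also have "\<dots> = s ^ 6"
    by (simp add: power_add[symmetric])
  finally have "s ^ 4 \<le> s ^ 6 / N"
    using assms by (simp add: field_simps)
  then show ?thesis
    by (smt (verit) zero_le_power2)
qed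

text \<open>What the argument retains of the signed noise entries. They need not be identically
  distributed; the common \<open>B\<close> makes all later bounds uniform over the noise
  class.\<close>

locale std_indep_family = prob_space M for M :: "'a measure" +
  fixes X :: "'i \<Rightarrow> 'a \<Rightarrow> real" and J :: "'i set" and B :: real
  assumes finite_J: "finite J"
    and indep: "indep_vars (\<lambda>_. borel) X J"
    and mean_zero: "i \<in> J \<Longrightarrow> expectation (X i) = 0"
    and unit_variance: "i \<in> J \<Longrightarrow> expectation (\<lambda>\<omega>. (X i \<omega>)\<^sup>2) = 1"
    and integrable_sixth: "i \<in> J \<Longrightarrow> integrable M (\<lambda>\<omega>. X i \<omega> ^ 6)"
    and sixth_moment_le: "i \<in> J \<Longrightarrow> expectation (\<lambda>\<omega>. X i \<omega> ^ 6) \<le> B"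
    and B_nonneg: "0 \<le> B"
begin

section \<open>Sixth and self-normalized exponential moments of sums\<close>

lemma random_variable_X: "i \<in> J \<Longrightarrow> random_variable borel (X i)"
  using indep by (auto simp: indep_vars_def)

lemma integrable_X_power: "i \<in> J \<Longrightarrow> k \<le> 6 \<Longrightarrow> integrable M (\<lambda>\<omega>. X i \<omega> ^ k)"
  by (rule integrable_power_le[OF random_variable_X integrable_sixth])

lemma integrable_X: "i \<in> J \<Longrightarrow> integrable M (X i)"
  using integrable_X_power[of i 1] by simp

text \<open>
  The auxiliary parameter \<open>N\<close> will be \<open>card J\<close>. Bounding the fourth moment of a partial sum by its
  sixth moment and \<open>N\<^sup>2\<close> closes the recursion, so that no other moment has to be estimated.
\<close>

lemma sum_sixth_moment_aux:
  assumes "0 < N" "I \<subseteq> J"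
  shows "integrable M (\<lambda>\<omega>. (\<Sum>i\<in>I. X i \<omega>) ^ 6) \<and>
    expectation (\<lambda>\<omega>. (\<Sum>i\<in>I. X i \<omega>) ^ 6) \<le> (1 + 39 / N) ^ card I * (real (card I) * (39 * (N\<^sup>2 + B)))"
proof -
  have "finite I"
    using assms(2) finite_J by (rule finite_subset)
  then show ?thesis
    using assms(2)
  proof (induction I rule: finite_induct)
    case empty
    then show ?case by simp
  next
    case (insert i I)
    let ?S = "\<lambda>\<omega>. \<Sum>i\<in>I. X i \<omega>"
    let ?c = "1 + 39 / N" and ?D = "39 * (N\<^sup>2 + B)"
    have i: "i \<in> J" and IJ: "I \<subseteq> J"
      using insert.prems by auto
    note IH = insert.IH[OF IJ]
    have rvX [measurable]: "random_variable borel (X i)"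
      by (rule random_variable_X[OF i])
    have rvS [measurable]: "random_variable borel ?S"
      using random_variable_X IJ by (intro borel_measurable_sum) auto
    have intS: "integrable M (\<lambda>\<omega>. ?S \<omega> ^ k)" if "k \<le> 6" for k
      by (rule integrable_power_le[OF rvS conjunct1[OF IH] that])
    have ind: "indep_var borel (X i) borel ?S"
      using insert.hyps indep_vars_subset[OF indep insert.prems] by (intro indep_vars_sum)
    have prod: "integrable M (\<lambda>\<omega>. X i \<omega> ^ k * ?S \<omega> ^ l)"
        "expectation (\<lambda>\<omega>. X i \<omega> ^ k * ?S \<omega> ^ l) =
          expectation (\<lambda>\<omega>. X i \<omega> ^ k) * expectation (\<lambda>\<omega>. ?S \<omega> ^ l)"
      if "k \<le> 6" "l \<le> 6" for k l
    proof -
      have "indep_var borel ((\<lambda>x. x ^ k) \<circ> X i) borel ((\<lambda>x. x ^ l) \<circ> ?S)"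
        by (rule indep_var_compose[OF ind]) auto
      then have *: "indep_var borel (\<lambda>\<omega>. X i \<omega> ^ k) borel (\<lambda>\<omega>. ?S \<omega> ^ l)"
        by (simp add: comp_def)
      show "integrable M (\<lambda>\<omega>. X i \<omega> ^ k * ?S \<omega> ^ l)"
        by (rule indep_var_integrable[OF * integrable_X_power[OF i that(1)] intS[OF that(2)]])
      show "expectation (\<lambda>\<omega>. X i \<omega> ^ k * ?S \<omega> ^ l) =
          expectation (\<lambda>\<omega>. X i \<omega> ^ k) * expectation (\<lambda>\<omega>. ?S \<omega> ^ l)"
        by (rule indep_var_lebesgue_integral[OF * integrable_X_power[OF i that(1)] intS[OF that(2)]])
    qed
    have eq: "(\<lambda>\<omega>. (\<Sum>i\<in>insert i I. X i \<omega>) ^ 6) = (\<lambda>\<omega>. (?S \<omega> + X i \<omega>) ^ 6)"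
      using insert.hyps by (simp add: add.commute)
    let ?R = "\<lambda>\<omega>. ?S \<omega> ^ 6 + 6 * (X i \<omega> * ?S \<omega> ^ 5) + 39 * (X i \<omega> ^ 2 * ?S \<omega> ^ 4 + X i \<omega> ^ 6)"
    have intR: "integrable M ?R"
      using prod(1)[of 1 5] prod(1)[of 2 4] intS[of 6] integrable_X_power[OF i, of 6] by simp
    have int: "integrable M (\<lambda>\<omega>. (?S \<omega> + X i \<omega>) ^ 6)"
    proof (rule Bochner_Integration.integrable_bound[OF intR])
      show "AE \<omega> in M. norm ((?S \<omega> + X i \<omega>) ^ 6) \<le> norm (?R \<omega>)"
      proof (rule AE_I2)
        fix \<omega>
        have "0 \<le> (?S \<omega> + X i \<omega>) ^ 6"
          by simp
        then show "norm ((?S \<omega> + X i \<omega>) ^ 6) \<le> norm (?R \<omega>)"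
          using sixth_power_add_le[of "?S \<omega>" "X i \<omega>"] unfolding real_norm_def by linarith
      qed
    qed measurable
    have "expectation (\<lambda>\<omega>. (?S \<omega> + X i \<omega>) ^ 6) \<le> expectation ?R"
      by (intro integral_mono int intR sixth_power_add_le)
    \<comment> \<open>The term with \<open>?S \<omega> ^ 5\<close> vanishes because
      \<open>X i\<close> is centered and independent of \<open>?S\<close>; unit variance removes the
      factor \<open>X i \<omega> ^ 2\<close>.\<close>
    also have "\<dots> = expectation (\<lambda>\<omega>. ?S \<omega> ^ 6) + 39 * (expectation (\<lambda>\<omega>. ?S \<omega> ^ 4) + expectation (\<lambda>\<omega>. X i \<omega> ^ 6))"
      using prod[of 1 5] prod[of 2 4] intS[of 6] integrable_X_power[OF i, of 6] mean_zero[OF i] unit_variance[OF i]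
      by simp
    also have "\<dots> \<le> expectation (\<lambda>\<omega>. ?S \<omega> ^ 6) + 39 * ((expectation (\<lambda>\<omega>. ?S \<omega> ^ 6) / N + N\<^sup>2) + B)"
    proof -
      have "expectation (\<lambda>\<omega>. ?S \<omega> ^ 4) \<le> expectation (\<lambda>\<omega>. ?S \<omega> ^ 6 / N + N\<^sup>2)"
        using intS[of 4] intS[of 6] fourth_power_le[OF assms(1)] by (intro integral_mono) auto
      also have "\<dots> = expectation (\<lambda>\<omega>. ?S \<omega> ^ 6) / N + N\<^sup>2"
        using intS[of 6] by (simp add: prob_space)
      finally show ?thesis
        using sixth_moment_le[OF i] by simp
    qed
    also have "\<dots> = ?c * expectation (\<lambda>\<omega>. ?S \<omega> ^ 6) + ?D"
      by (simp add: field_simps)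
    \<comment> \<open>The affine recursion with factor \<open>?c\<close> and increment
      \<open>?D\<close> is solved after weakening the increment to
      \<open>?c ^ Suc (card I) * ?D\<close>, which gives the closed form.\<close>
    also have "\<dots> \<le> ?c * (?c ^ card I * (real (card I) * ?D)) + ?c ^ Suc (card I) * ?D"
    proof (intro add_mono mult_left_mono)
      have "1 * ?D \<le> ?c ^ Suc (card I) * ?D"
        using assms(1) B_nonneg by (intro mult_right_mono one_le_power) auto
      then show "?D \<le> ?c ^ Suc (card I) * ?D" by simp
    qed (use IH assms(1) in auto)
    also have "\<dots> = ?c ^ card (insert i I) * (real (card (insert i I)) * ?D)"
    proof -
      have "c * (c ^ k * (real k * D)) + c ^ Suc k * D = c ^ Suc k * (real (Suc k) * D)" for c D and k :: nat
        by (simp add: algebra_simps)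
      then show ?thesis
        using insert.hyps by simp
    qed
    finally show ?case
      unfolding eq using int by blast
  qed
qed

lemma integrable_sum_sixth: "integrable M (\<lambda>\<omega>. (\<Sum>i\<in>J. X i \<omega>) ^ 6)"
  using sum_sixth_moment_aux[of 1 J] by simp

text \<open>With \<open>N = card J\<close> the growth factor \<open>(1 + 39 / N) ^ card J\<close>
  stays below \<open>exp 39\<close>, so the sixth moment has the Gaussian order
  \<open>card J ^ 3\<close>.\<close>

lemma sum_sixth_moment_le:
  "expectation (\<lambda>\<omega>. (\<Sum>i\<in>J. X i \<omega>) ^ 6) \<le> 39 * exp 39 * (1 + B) * real (card J) ^ 3"
proof (cases "card J = 0")
  case True
  then show ?thesis using finite_J by simp
next
  case False
  let ?N = "real (card J)"
  have N: "1 \<le> ?N"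
    using False by linarith
  have "(1 + 39 / ?N) ^ card J \<le> exp (39 / ?N) ^ card J"
    using N by (intro power_mono exp_ge_add_one_self) auto
  also have "\<dots> = exp 39"
    using N by (simp add: exp_of_nat_mult[symmetric])
  finally have 1: "(1 + 39 / ?N) ^ card J \<le> exp 39" .
  have "B \<le> B * ?N\<^sup>2"
    using N B_nonneg mult_left_mono[of 1 "?N\<^sup>2" B] by simp
  then have "?N\<^sup>2 + B \<le> (1 + B) * ?N\<^sup>2"
    by (simp add: algebra_simps)
  then have 2: "?N * (39 * (?N\<^sup>2 + B)) \<le> ?N * (39 * ((1 + B) * ?N\<^sup>2))"
    by (intro mult_left_mono) auto
  have "expectation (\<lambda>\<omega>. (\<Sum>i\<in>J. X i \<omega>) ^ 6) \<le> (1 + 39 / ?N) ^ card J * (?N * (39 * (?N\<^sup>2 + B)))"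
    using sum_sixth_moment_aux[of ?N J] N by simp
  also have "\<dots> \<le> exp 39 * (?N * (39 * ((1 + B) * ?N\<^sup>2)))"
    using 1 2 N B_nonneg by (intro mult_mono) auto
  also have "\<dots> = 39 * exp 39 * (1 + B) * ?N ^ 3"
    by (simp add: power2_eq_square power3_eq_cube)
  finally show ?thesis .
qed

text \<open>The integrand factorizes over \<open>J\<close>. By \<open>exp_diff_square_le\<close>
  each factor has mean at most \<open>1 + s\<^sup>2\<close>, which uses only mean and variance;
  subtracting the sum of squares replaces any assumption on exponential moments.\<close>

lemma nn_integral_self_normalized_exp:
  "(\<integral>\<^sup>+\<omega>. ennreal (exp (s * (\<Sum>i\<in>J. X i \<omega>) - s\<^sup>2 * (\<Sum>i\<in>J. (X i \<omega>)\<^sup>2))) \<partial>M) \<le>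
    ennreal (exp (real (card J) * s\<^sup>2))"
proof -
  have "(\<integral>\<^sup>+\<omega>. ennreal (exp (s * (\<Sum>i\<in>J. X i \<omega>) - s\<^sup>2 * (\<Sum>i\<in>J. (X i \<omega>)\<^sup>2))) \<partial>M) =
      (\<integral>\<^sup>+\<omega>. (\<Prod>i\<in>J. ennreal (exp (s * X i \<omega> - (s * X i \<omega>)\<^sup>2))) \<partial>M)"
    using finite_J
    by (simp add: prod_ennreal exp_sum[symmetric] sum_subtractf sum_distrib_left power_mult_distrib)
  also have "\<dots> = (\<Prod>i\<in>J. \<integral>\<^sup>+\<omega>. ennreal (exp (s * X i \<omega> - (s * X i \<omega>)\<^sup>2)) \<partial>M)"
    by (intro indep_vars_nn_integral finite_J indep_vars_compose2[OF indep]) auto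
  also have "\<dots> \<le> (\<Prod>i\<in>J. ennreal (exp (s\<^sup>2)))"
  proof (rule prod_mono_ennreal)
    fix i assume i: "i \<in> J"
    have "0 \<le> 1 + y + y\<^sup>2" for y :: real
      using exp_diff_square_le[of y] exp_ge_zero[of "y - y\<^sup>2"] by linarith
    then have nn: "0 \<le> 1 + s * X i \<omega> + (s * X i \<omega>)\<^sup>2" for \<omega> by blast
    have int: "integrable M (\<lambda>\<omega>. 1 + s * X i \<omega> + (s * X i \<omega>)\<^sup>2)"
      using integrable_X[OF i] integrable_X_power[OF i, of 2] by (simp add: power_mult_distrib)
    have "(\<integral>\<^sup>+\<omega>. ennreal (exp (s * X i \<omega> - (s * X i \<omega>)\<^sup>2)) \<partial>M) \<le>
        (\<integral>\<^sup>+\<omega>. ennreal (1 + s * X i \<omega> + (s * X i \<omega>)\<^sup>2) \<partial>M)"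
      by (intro nn_integral_mono ennreal_leI exp_diff_square_le)
    also have "\<dots> = ennreal (expectation (\<lambda>\<omega>. 1 + s * X i \<omega> + (s * X i \<omega>)\<^sup>2))"
      using int nn by (intro nn_integral_eq_integral) auto
    also have "expectation (\<lambda>\<omega>. 1 + s * X i \<omega> + (s * X i \<omega>)\<^sup>2) = 1 + s\<^sup>2"
      using integrable_X[OF i] integrable_X_power[OF i, of 2] mean_zero[OF i] unit_variance[OF i]
      by (simp add: power_mult_distrib prob_space)
    also have "\<dots> \<le> exp (s\<^sup>2)"
      by (rule exp_ge_add_one_self)
    finally show "(\<integral>\<^sup>+\<omega>. ennreal (exp (s * X i \<omega> - (s * X i \<omega>)\<^sup>2)) \<partial>M) \<le> ennreal (exp (s\<^sup>2))"
      by (simp add: ennreal_leI)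
  qed
  also have "\<dots> = ennreal (exp (real (card J) * s\<^sup>2))"
    by (simp add: ennreal_power exp_of_nat_mult[symmetric])
  finally show ?thesis .
qed

text \<open>
  Integrating the preceding bound over \<open>s = u / sqrt (card J)\<close> with \<open>u\<close> normal of variance \<open>1 / 12\<close>.
\<close>

lemma nn_integral_exp_sum_square_le:
  assumes "J \<noteq> {}"
  shows "(\<integral>\<^sup>+\<omega>. ennreal (of_bool ((\<Sum>i\<in>J. (X i \<omega>)\<^sup>2) \<le> 2 * real (card J)) *
      exp ((\<Sum>i\<in>J. X i \<omega>)\<^sup>2 / (24 * real (card J)))) \<partial>M) \<le> ennreal (sqrt 2)"
proof -
  let ?m = "real (card J)"
  let ?S = "\<lambda>\<omega>. \<Sum>i\<in>J. X i \<omega>" and ?Q = "\<lambda>\<omega>. \<Sum>i\<in>J. (X i \<omega>)\<^sup>2"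
  let ?n = "normal_density 0 (sqrt (1 / 12))"
  have m: "0 < ?m"
    using assms finite_J by (simp add: card_gt_0_iff)
  have [measurable]: "random_variable borel ?S" "random_variable borel ?Q"
    using random_variable_X by (auto intro!: borel_measurable_sum)
  interpret L: pair_sigma_finite M lborel ..
  \<comment> \<open>The factor \<open>exp (2 * u\<^sup>2)\<close> compensates the subtracted term
    \<open>(u / sqrt ?m)\<^sup>2 * ?Q \<omega>\<close>, which is at most
    \<open>2 * u\<^sup>2\<close> on the regular event.\<close>
  let ?f = "\<lambda>\<omega> u. ennreal (exp (u / sqrt ?m * ?S \<omega> - (u / sqrt ?m)\<^sup>2 * ?Q \<omega>)) *
      ennreal (exp (2 * u\<^sup>2) * ?n u)"
  have "(\<integral>\<^sup>+\<omega>. ennreal (of_bool (?Q \<omega> \<le> 2 * ?m) * exp ((?S \<omega>)\<^sup>2 / (24 * ?m))) \<partial>M) \<le>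
      (\<integral>\<^sup>+\<omega>. (\<integral>\<^sup>+u. ?f \<omega> u \<partial>lborel) \<partial>M)"
  proof (intro nn_integral_mono)
    fix \<omega>
    show "ennreal (of_bool (?Q \<omega> \<le> 2 * ?m) * exp ((?S \<omega>)\<^sup>2 / (24 * ?m))) \<le> (\<integral>\<^sup>+u. ?f \<omega> u \<partial>lborel)"
    proof (cases "?Q \<omega> \<le> 2 * ?m")
      case True
      \<comment> \<open>The Gaussian moment generating function read backwards: variance 1/12 turns
        an average of exponentials linear in \<open>?S \<omega>\<close> into the exponential of its
        square, with 24 = 2 * 12.\<close>
      have "ennreal (exp ((?S \<omega>)\<^sup>2 / (24 * ?m))) =
          (\<integral>\<^sup>+u. ennreal (exp (u * (?S \<omega> / sqrt ?m)) * ?n u) \<partial>lborel)"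
        using m by (subst nn_integral_exp_normal_density) (auto simp: power_divide)
      also have "\<dots> \<le> (\<integral>\<^sup>+u. ?f \<omega> u \<partial>lborel)"
      proof (intro nn_integral_mono)
        fix u :: real
        have "u\<^sup>2 * ?Q \<omega> \<le> u\<^sup>2 * (2 * ?m)"
          using True by (intro mult_left_mono) auto
        then have "(u / sqrt ?m)\<^sup>2 * ?Q \<omega> \<le> 2 * u\<^sup>2"
          using m by (simp add: power_divide field_simps)
        then have "exp (u * (?S \<omega> / sqrt ?m)) \<le>
            exp (u / sqrt ?m * ?S \<omega> - (u / sqrt ?m)\<^sup>2 * ?Q \<omega>) * exp (2 * u\<^sup>2)"
          by (simp add: mult_exp_exp)
        then have "exp (u * (?S \<omega> / sqrt ?m)) * ?n u \<le>
            exp (u / sqrt ?m * ?S \<omega> - (u / sqrt ?m)\<^sup>2 * ?Q \<omega>) * exp (2 * u\<^sup>2) * ?n u"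
          by (intro mult_right_mono) auto
        then show "ennreal (exp (u * (?S \<omega> / sqrt ?m)) * ?n u) \<le> ?f \<omega> u"
          by (simp add: ennreal_mult[symmetric] mult.assoc ennreal_leI)
      qed
      finally show ?thesis
        using True by simp
    qed simp
  qed
  also have "\<dots> = (\<integral>\<^sup>+u. (\<integral>\<^sup>+\<omega>. ?f \<omega> u \<partial>M) \<partial>lborel)"
    by (rule L.Fubini'[symmetric]) measurable
  \<comment> \<open>After exchanging the integrals \<open>u\<close> is fixed and the self-normalized
    bound gives \<open>exp (u\<^sup>2)\<close>; together with the compensation the exponent is
    \<open>3 * u\<^sup>2\<close>.\<close>
  also have "\<dots> \<le> (\<integral>\<^sup>+u. ennreal (exp (3 * u\<^sup>2) * ?n u) \<partial>lborel)"
  proof (intro nn_integral_mono)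
    fix u :: real
    have "(\<integral>\<^sup>+\<omega>. ?f \<omega> u \<partial>M) =
        (\<integral>\<^sup>+\<omega>. ennreal (exp (u / sqrt ?m * ?S \<omega> - (u / sqrt ?m)\<^sup>2 * ?Q \<omega>)) \<partial>M) * ennreal (exp (2 * u\<^sup>2) * ?n u)"
      by (rule nn_integral_multc) measurable
    also have "\<dots> \<le> ennreal (exp (?m * (u / sqrt ?m)\<^sup>2)) * ennreal (exp (2 * u\<^sup>2) * ?n u)"
      by (intro mult_right_mono nn_integral_self_normalized_exp) auto
    also have "\<dots> = ennreal (exp (3 * u\<^sup>2) * ?n u)"
    proof -
      have "exp (?m * (u / sqrt ?m)\<^sup>2) * exp (2 * u\<^sup>2) = exp (3 * u\<^sup>2)"
        using m by (simp add: mult_exp_exp power_divide)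
      then show ?thesis
        by (simp add: ennreal_mult[symmetric] mult.assoc[symmetric])
    qed
    finally show "(\<integral>\<^sup>+\<omega>. ?f \<omega> u \<partial>M) \<le> ennreal (exp (3 * u\<^sup>2) * ?n u)" .
  qed
  also have "\<dots> = ennreal (sqrt 2)"
    by (rule nn_integral_exp_square_normal_density)
  finally show ?thesis .
qed

text \<open>The sum of squares has mean \<open>card J\<close>, so the event is a deviation by at
  least its mean. Chebyshev applies because the sixth moment dominates the variance of each
  square.\<close>

lemma prob_sum_squares_gt:
  assumes "J \<noteq> {}"
  shows "prob {\<omega> \<in> space M. 2 * real (card J) < (\<Sum>i\<in>J. (X i \<omega>)\<^sup>2)} \<le> (2 + B) / real (card J)"
proof -
  let ?m = "real (card J)"
  have m: "0 < ?m"
    using assms finite_J by (simp add: card_gt_0_iff)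
  let ?Z = "\<lambda>i \<omega>. (X i \<omega>)\<^sup>2 - 1"
  have [measurable]: "random_variable borel (X i)" if "i \<in> J" for i
    using random_variable_X that .
  have le: "(x\<^sup>2 - 1)\<^sup>2 \<le> 2 + x ^ 6" for x :: real
  proof -
    have "x ^ 4 \<le> 1 + x ^ 6"
      using abs_power_le_one_plus[of 4 6 x] by (simp add: abs_of_nonneg)
    then show ?thesis
      by (simp add: power2_diff power_mult[symmetric]) (smt (verit) zero_le_power2)
  qed
  have int: "integrable M (\<lambda>\<omega>. (?Z i \<omega>)\<^sup>2)" if "i \<in> J" for i
  proof (rule Bochner_Integration.integrable_bound)
    show "integrable M (\<lambda>\<omega>. 2 + X i \<omega> ^ 6)"
      using integrable_sixth[OF that] by simp
    show "AE \<omega> in M. norm ((?Z i \<omega>)\<^sup>2) \<le> norm (2 + X i \<omega> ^ 6)"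
      using le by (auto simp: abs_of_nonneg)
  qed (use that in measurable)
  have "prob {\<omega> \<in> space M. 2 * ?m < (\<Sum>i\<in>J. (X i \<omega>)\<^sup>2)} \<le>
      prob {\<omega> \<in> space M. ?m \<le> \<bar>\<Sum>i\<in>J. ?Z i \<omega>\<bar>}"
    by (intro finite_measure_mono) (auto simp: sum_subtractf)
  also have "\<dots> \<le> (\<Sum>i\<in>J. 2 + B) / ?m\<^sup>2"
  proof (rule prob_abs_sum_ge[OF finite_J _ int _ _ m])
    show "indep_vars (\<lambda>_. borel) ?Z J"
      by (rule indep_vars_compose2[OF indep]) auto
    fix i assume i: "i \<in> J"
    show "expectation (?Z i) = 0"
      using unit_variance[OF i] integrable_X_power[OF i, of 2] by (simp add: prob_space)
    have "expectation (\<lambda>\<omega>. (?Z i \<omega>)\<^sup>2) \<le> expectation (\<lambda>\<omega>. 2 + X i \<omega> ^ 6)"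
      using int[OF i] integrable_sixth[OF i] le by (intro integral_mono) auto
    also have "\<dots> \<le> 2 + B"
      using integrable_sixth[OF i] sixth_moment_le[OF i] by (simp add: prob_space)
    finally show "expectation (\<lambda>\<omega>. (?Z i \<omega>)\<^sup>2) \<le> 2 + B" .
  qed
  also have "\<dots> = (2 + B) / ?m"
    using m by (simp add: power2_eq_square)
  finally show ?thesis .
qed

end

section \<open>Sums of squares of normalized block sums\<close>

text \<open>With the signs of the contrast absorbed into \<open>x\<close>, this is the summand of
  \<open>A_stat\<close> that belongs to one row under the null hypothesis.\<close>

definition block_excess :: "('i \<Rightarrow> real) \<Rightarrow> 'i set \<Rightarrow> real" where
  "block_excess x I = (\<Sum>i\<in>I. x i)\<^sup>2 / real (card I) - 1"

text \<open>The cut is at twice the mean of the sum of squares: low enough for exponential moments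
  on the event, high enough for its complement to be rare.\<close>

definition regular_block :: "('i \<Rightarrow> real) \<Rightarrow> 'i set \<Rightarrow> bool" where
  "regular_block x I \<longleftrightarrow> (\<Sum>i\<in>I. (x i)\<^sup>2) \<le> 2 * real (card I)"

definition regular_excess :: "('i \<Rightarrow> real) \<Rightarrow> 'i set \<Rightarrow> real" where
  "regular_excess x I = of_bool (regular_block x I) * block_excess x I"

definition irregular_excess :: "('i \<Rightarrow> real) \<Rightarrow> 'i set \<Rightarrow> real" where
  "irregular_excess x I = of_bool (\<not> regular_block x I) * block_excess x I"

lemma regular_plus_irregular_excess: "regular_excess x I + irregular_excess x I = block_excess x I"
  by (simp add: regular_excess_def irregular_excess_def)

text \<open>A restriction to \<open>I\<close> unfolds to this conditional form; the equation
  discharges the locality condition of \<open>indep_vars_blocks\<close>.\<close>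

lemma block_excess_if_mem: "block_excess (\<lambda>i. if i \<in> I then x i else c) I = block_excess x I"
  by (simp add: block_excess_def)

lemma regular_block_if_mem: "regular_block (\<lambda>i. if i \<in> I then x i else c) I = regular_block x I"
  by (simp add: regular_block_def)

lemma measurable_block_excess [measurable]:
  "(\<lambda>x. block_excess x I) \<in> borel_measurable (Pi\<^sub>M I (\<lambda>_. borel))"
  unfolding block_excess_def by measurable

lemma measurable_regular_block [measurable]:
  "Measurable.pred (Pi\<^sub>M I (\<lambda>_. borel)) (\<lambda>x. regular_block x I)"
  unfolding regular_block_def by measurable

lemma block_excess_square_le:
  "(block_excess x I)\<^sup>2 \<le> ((\<Sum>i\<in>I. x i) / sqrt (real (card I))) ^ 4 + 1"
proof -
  let ?y = "(\<Sum>i\<in>I. x i) / sqrt (real (card I))"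
  have "block_excess x I = ?y\<^sup>2 - 1"
    by (simp add: block_excess_def power_divide)
  then have "(block_excess x I)\<^sup>2 = ?y ^ 4 + 1 - 2 * ?y\<^sup>2"
    by (simp add: power2_diff power_mult[symmetric])
  then show ?thesis
    using zero_le_power2[of ?y] by linarith
qed

text \<open>\<open>fourth_power_le\<close> with \<open>N = 1 / a\<close>, applied to the normalized
  sum. A small \<open>a\<close> discounts the sixth moment at the price of a large constant, which
  will be integrated over a rare event only.\<close>

lemma block_excess_square_le_sixth:
  "0 < a \<Longrightarrow> (block_excess x I)\<^sup>2 \<le> a * ((\<Sum>i\<in>I. x i) ^ 6 / real (card I) ^ 3) + (1 / a\<^sup>2 + 1)"
proof -
  assume a: "0 < a"
  let ?y = "(\<Sum>i\<in>I. x i) / sqrt (real (card I))"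
  have "sqrt (real (card I)) ^ 6 = (sqrt (real (card I)) ^ 2) ^ 3"
    unfolding power_mult[symmetric] by simp
  then have "?y ^ 6 = (\<Sum>i\<in>I. x i) ^ 6 / real (card I) ^ 3"
    by (simp add: power_divide)
  moreover have "y ^ 4 \<le> a * y ^ 6 + 1 / a\<^sup>2" for y :: real
    using fourth_power_le[of "1 / a" y] a by (simp add: power_divide mult.commute)
  from this[of ?y] have "?y ^ 4 \<le> a * ?y ^ 6 + 1 / a\<^sup>2" .
  ultimately show ?thesis
    using block_excess_square_le[of x I] by simp
qed

definition sum_sixth_const :: "real \<Rightarrow> real" where
  "sum_sixth_const B = 39 * exp 39 * (1 + B)"

section \<open>Moments of the excess of a single block\<close>

context std_indep_family
begin

lemma std_indep_subfamily: "I \<subseteq> J \<Longrightarrow> std_indep_family M X I B"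
  using finite_J indep_vars_subset[OF indep] mean_zero unit_variance integrable_sixth sixth_moment_le B_nonneg
  by unfold_locales (auto intro: finite_subset)

lemma measurable_block_excess_X [measurable]:
  "(\<lambda>\<omega>. block_excess (\<lambda>i. X i \<omega>) J) \<in> borel_measurable M"
  using random_variable_X unfolding block_excess_def by measurable

lemma measurable_regular_block_X [measurable]: "Measurable.pred M (\<lambda>\<omega>. regular_block (\<lambda>i. X i \<omega>) J)"
  using random_variable_X unfolding regular_block_def by measurable

lemma measurable_regular_excess_X [measurable]:
  "(\<lambda>\<omega>. regular_excess (\<lambda>i. X i \<omega>) J) \<in> borel_measurable M"
  unfolding regular_excess_def by measurable

lemma measurable_irregular_excess_X [measurable]:
  "(\<lambda>\<omega>. irregular_excess (\<lambda>i. X i \<omega>) J) \<in> borel_measurable M"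
  unfolding irregular_excess_def by measurable

lemma integrable_sum: "integrable M (\<lambda>\<omega>. \<Sum>i\<in>J. X i \<omega>)"
  using integrable_X by (intro Bochner_Integration.integrable_sum) auto

lemma integrable_sum_square: "integrable M (\<lambda>\<omega>. (\<Sum>i\<in>J. X i \<omega>)\<^sup>2)"
  using integrable_X_power[of _ 2] mean_zero
  by (intro integrable_indep_vars_sum_square[OF finite_J indep]) auto

lemma expectation_sum: "expectation (\<lambda>\<omega>. \<Sum>i\<in>J. X i \<omega>) = 0"
  using integrable_X mean_zero by simp

lemma expectation_sum_square: "expectation (\<lambda>\<omega>. (\<Sum>i\<in>J. X i \<omega>)\<^sup>2) = real (card J)"
  using integrable_X_power[of _ 2] mean_zero unit_variance
  by (subst expectation_indep_vars_sum_square[OF finite_J indep]) auto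

lemma integrable_block_excess: "integrable M (\<lambda>\<omega>. block_excess (\<lambda>i. X i \<omega>) J)"
  unfolding block_excess_def using integrable_sum_square by simp

lemma integrable_regular_excess: "integrable M (\<lambda>\<omega>. regular_excess (\<lambda>i. X i \<omega>) J)"
  by (rule Bochner_Integration.integrable_bound[OF integrable_block_excess])
    (auto simp: regular_excess_def)

lemma integrable_irregular_excess: "integrable M (\<lambda>\<omega>. irregular_excess (\<lambda>i. X i \<omega>) J)"
  by (rule Bochner_Integration.integrable_bound[OF integrable_block_excess])
    (auto simp: irregular_excess_def)

context
  assumes J_nonempty: "J \<noteq> {}"
begin

lemma card_J_pos: "0 < real (card J)"
  using J_nonempty finite_J by (simp add: card_gt_0_iff)

lemma expectation_block_excess: "expectation (\<lambda>\<omega>. block_excess (\<lambda>i. X i \<omega>) J) = 0"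
  unfolding block_excess_def using integrable_sum_square expectation_sum_square card_J_pos
  by (simp add: prob_space)

lemma abs_expectation_regular_excess_le: "\<bar>expectation (\<lambda>\<omega>. regular_excess (\<lambda>i. X i \<omega>) J)\<bar> \<le> 2"
proof -
  have "\<bar>expectation (\<lambda>\<omega>. regular_excess (\<lambda>i. X i \<omega>) J)\<bar> \<le> expectation (\<lambda>\<omega>. \<bar>regular_excess (\<lambda>i. X i \<omega>) J\<bar>)"
    by (rule integral_abs_bound)
  also have "\<dots> \<le> expectation (\<lambda>\<omega>. (\<Sum>i\<in>J. X i \<omega>)\<^sup>2 / real (card J) + 1)"
  proof (rule integral_mono)
    fix \<omega>
    have "0 \<le> (\<Sum>i\<in>J. X i \<omega>)\<^sup>2 / real (card J)"
      by simp
    moreover have "regular_excess (\<lambda>i. X i \<omega>) J = (\<Sum>i\<in>J. X i \<omega>)\<^sup>2 / real (card J) - 1 \<or>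
        regular_excess (\<lambda>i. X i \<omega>) J = 0"
      by (simp add: regular_excess_def block_excess_def)
    ultimately show "\<bar>regular_excess (\<lambda>i. X i \<omega>) J\<bar> \<le> (\<Sum>i\<in>J. X i \<omega>)\<^sup>2 / real (card J) + 1"
      by (smt (verit))
  qed (use integrable_regular_excess integrable_sum_square in auto)
  also have "\<dots> = 2"
    using integrable_sum_square expectation_sum_square card_J_pos by (simp add: prob_space)
  finally show ?thesis .
qed

text \<open>On the regular event the centered excess is at most the squared normalized sum plus 3,
  where 3 = 1 + 2 and 2 bounds the centering \<open>e\<close>; off it, at most 3. Hence the factor
  \<open>exp (1 / 8)\<close>, with 1/8 = 3/24, while \<open>sqrt 2\<close> comes from
  \<open>nn_integral_exp_sum_square_le\<close>.\<close>

lemma exp_regular_excess: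
  defines "e \<equiv> expectation (\<lambda>\<omega>. regular_excess (\<lambda>i. X i \<omega>) J)"
  shows integrable_exp_regular_excess:
      "integrable M (\<lambda>\<omega>. exp (1 / 24 * \<bar>regular_excess (\<lambda>i. X i \<omega>) J - e\<bar>))"
    and expectation_exp_regular_excess_le:
      "expectation (\<lambda>\<omega>. exp (1 / 24 * \<bar>regular_excess (\<lambda>i. X i \<omega>) J - e\<bar>)) \<le> exp (1 / 8) * (1 + sqrt 2)"
proof -
  let ?g = "\<lambda>\<omega>. of_bool ((\<Sum>i\<in>J. (X i \<omega>)\<^sup>2) \<le> 2 * real (card J)) *
      exp ((\<Sum>i\<in>J. X i \<omega>)\<^sup>2 / (24 * real (card J)))"
  have [measurable]: "?g \<in> borel_measurable M"
    using random_variable_X by measurable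
  have intg: "integrable M ?g"
  proof (rule integrableI_nonneg)
    show "(\<integral>\<^sup>+\<omega>. ennreal (?g \<omega>) \<partial>M) < \<infinity>"
      using nn_integral_exp_sum_square_le[OF J_nonempty] by (auto simp: top_unique less_top[symmetric])
  qed auto
  have "ennreal (expectation ?g) \<le> ennreal (sqrt 2)"
    using nn_integral_exp_sum_square_le[OF J_nonempty] nn_integral_eq_integral[OF intg] by simp
  then have Eg: "expectation ?g \<le> sqrt 2"
    by (simp add: ennreal_le_iff)
  have le: "exp (1 / 24 * \<bar>regular_excess (\<lambda>i. X i \<omega>) J - e\<bar>) \<le> exp (1 / 8) * (1 + ?g \<omega>)" for \<omega>
  proof (cases "regular_block (\<lambda>i. X i \<omega>) J")
    case True
    let ?y = "(\<Sum>i\<in>J. X i \<omega>)\<^sup>2 / real (card J)"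
    have "0 \<le> ?y" by simp
    moreover have "regular_excess (\<lambda>i. X i \<omega>) J = ?y - 1"
      using True by (simp add: regular_excess_def block_excess_def)
    ultimately have "\<bar>regular_excess (\<lambda>i. X i \<omega>) J - e\<bar> \<le> ?y + 3"
      using abs_expectation_regular_excess_le unfolding e_def[symmetric] by linarith
    then have "exp (1 / 24 * \<bar>regular_excess (\<lambda>i. X i \<omega>) J - e\<bar>) \<le> exp (1 / 8 + ?y / 24)"
      by simp
    also have "\<dots> = exp (1 / 8) * ?g \<omega>"
      using True by (simp add: regular_block_def exp_add mult.commute)
    also have "\<dots> \<le> exp (1 / 8) * (1 + ?g \<omega>)"
      by simp
    finally show ?thesis .
  next
    case False
    then have "\<bar>regular_excess (\<lambda>i. X i \<omega>) J - e\<bar> \<le> 3"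
      using abs_expectation_regular_excess_le unfolding e_def[symmetric] by (simp add: regular_excess_def)
    then have "exp (1 / 24 * \<bar>regular_excess (\<lambda>i. X i \<omega>) J - e\<bar>) \<le> exp (1 / 8) * 1"
      by simp
    also have "\<dots> \<le> exp (1 / 8) * (1 + ?g \<omega>)"
      by (intro mult_left_mono) auto
    finally show ?thesis .
  qed
  show int: "integrable M (\<lambda>\<omega>. exp (1 / 24 * \<bar>regular_excess (\<lambda>i. X i \<omega>) J - e\<bar>))"
  proof (rule Bochner_Integration.integrable_bound)
    show "integrable M (\<lambda>\<omega>. exp (1 / 8) * (1 + ?g \<omega>))"
      using intg by simp
    show "AE \<omega> in M. norm (exp (1 / 24 * \<bar>regular_excess (\<lambda>i. X i \<omega>) J - e\<bar>)) \<le> norm (exp (1 / 8) * (1 + ?g \<omega>))"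
      using le by (intro AE_I2) (simp only: real_norm_def abs_exp_cancel, meson abs_ge_self order_trans)
  qed measurable
  have "expectation (\<lambda>\<omega>. exp (1 / 24 * \<bar>regular_excess (\<lambda>i. X i \<omega>) J - e\<bar>)) \<le>
      expectation (\<lambda>\<omega>. exp (1 / 8) * (1 + ?g \<omega>))"
    using intg by (intro integral_mono int le) simp
  also have "\<dots> = exp (1 / 8) * (1 + expectation ?g)"
    using intg by (simp add: prob_space)
  also have "\<dots> \<le> exp (1 / 8) * (1 + sqrt 2)"
    using Eg by simp
  finally show "expectation (\<lambda>\<omega>. exp (1 / 24 * \<bar>regular_excess (\<lambda>i. X i \<omega>) J - e\<bar>)) \<le> exp (1 / 8) * (1 + sqrt 2)" .
qed

lemma expectation_sum_sixth_normalized_le: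
  "expectation (\<lambda>\<omega>. (\<Sum>i\<in>J. X i \<omega>) ^ 6 / real (card J) ^ 3) \<le> sum_sixth_const B"
  using sum_sixth_moment_le card_J_pos integrable_sum_sixth
  by (simp add: sum_sixth_const_def pos_divide_le_eq)

lemma block_excess_square:
  shows integrable_block_excess_square: "integrable M (\<lambda>\<omega>. (block_excess (\<lambda>i. X i \<omega>) J)\<^sup>2)"
    and expectation_block_excess_square_le:
      "expectation (\<lambda>\<omega>. (block_excess (\<lambda>i. X i \<omega>) J)\<^sup>2) \<le> sum_sixth_const B + 2"
proof -
  let ?h = "\<lambda>\<omega>. (\<Sum>i\<in>J. X i \<omega>) ^ 6 / real (card J) ^ 3 + 2"
  have le: "(block_excess (\<lambda>i. X i \<omega>) J)\<^sup>2 \<le> ?h \<omega>" for \<omega>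
    using block_excess_square_le_sixth[of 1 "\<lambda>i. X i \<omega>" J] by simp
  show int: "integrable M (\<lambda>\<omega>. (block_excess (\<lambda>i. X i \<omega>) J)\<^sup>2)"
  proof (rule Bochner_Integration.integrable_bound)
    show "integrable M ?h"
      using integrable_sum_sixth by simp
    show "AE \<omega> in M. norm ((block_excess (\<lambda>i. X i \<omega>) J)\<^sup>2) \<le> norm (?h \<omega>)"
      using le by (auto simp: abs_of_nonneg)
  qed measurable
  have "expectation (\<lambda>\<omega>. (block_excess (\<lambda>i. X i \<omega>) J)\<^sup>2) \<le> expectation ?h"
    using integrable_sum_sixth by (intro integral_mono int le) simp
  also have "\<dots> = expectation (\<lambda>\<omega>. (\<Sum>i\<in>J. X i \<omega>) ^ 6 / real (card J) ^ 3) + 2"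
    using integrable_sum_sixth by (subst Bochner_Integration.integral_add) (auto simp: prob_space)
  also have "\<dots> \<le> sum_sixth_const B + 2"
    using expectation_sum_sixth_normalized_le by simp
  finally show "expectation (\<lambda>\<omega>. (block_excess (\<lambda>i. X i \<omega>) J)\<^sup>2) \<le> sum_sixth_const B + 2" .
qed

lemma integrable_irregular_excess_square: "integrable M (\<lambda>\<omega>. (irregular_excess (\<lambda>i. X i \<omega>) J)\<^sup>2)"
  by (rule Bochner_Integration.integrable_bound[OF integrable_block_excess_square])
    (auto simp: irregular_excess_def)

text \<open>The sixth-power part of the pointwise bound is integrated over the whole space with
  weight \<open>a\<close>, the constant part only over the irregular event, whose probability is of
  order \<open>1 / card J\<close>.\<close>

lemma expectation_irregular_excess_square_le:
  assumes a: "0 < a"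
  shows "expectation (\<lambda>\<omega>. (irregular_excess (\<lambda>i. X i \<omega>) J)\<^sup>2) \<le>
    a * sum_sixth_const B + (1 / a\<^sup>2 + 1) * ((2 + B) / real (card J))"
proof -
  let ?A = "{\<omega> \<in> space M. 2 * real (card J) < (\<Sum>i\<in>J. (X i \<omega>)\<^sup>2)}"
  let ?y = "\<lambda>\<omega>. (\<Sum>i\<in>J. X i \<omega>) ^ 6 / real (card J) ^ 3"
  have [measurable]: "?A \<in> sets M"
    using random_variable_X by measurable
  have intA: "integrable M (indicat_real ?A)"
    by (rule integrable_real_indicator) (auto simp: emeasure_eq_measure)
  have "expectation (\<lambda>\<omega>. (irregular_excess (\<lambda>i. X i \<omega>) J)\<^sup>2) \<le>
      expectation (\<lambda>\<omega>. a * ?y \<omega> + (1 / a\<^sup>2 + 1) * indicator ?A \<omega>)"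
  proof (rule integral_mono[OF integrable_irregular_excess_square])
    show "integrable M (\<lambda>\<omega>. a * ?y \<omega> + (1 / a\<^sup>2 + 1) * indicator ?A \<omega>)"
      using integrable_sum_sixth intA by simp
    fix \<omega> assume "\<omega> \<in> space M"
    moreover have "0 \<le> a * ?y \<omega>"
      using a by simp
    ultimately show "(irregular_excess (\<lambda>i. X i \<omega>) J)\<^sup>2 \<le> a * ?y \<omega> + (1 / a\<^sup>2 + 1) * indicator ?A \<omega>"
      using block_excess_square_le_sixth[OF a, of "\<lambda>i. X i \<omega>" J]
      by (cases "regular_block (\<lambda>i. X i \<omega>) J") (auto simp: irregular_excess_def regular_block_def)
  qed
  also have "\<dots> = a * expectation ?y + (1 / a\<^sup>2 + 1) * prob ?A"
    using integrable_sum_sixth intA by (subst Bochner_Integration.integral_add) auto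
  also have "\<dots> \<le> a * sum_sixth_const B + (1 / a\<^sup>2 + 1) * ((2 + B) / real (card J))"
    using a by (intro add_mono mult_left_mono expectation_sum_sixth_normalized_le prob_sum_squares_gt[OF J_nonempty]) auto
  finally show ?thesis .
qed

end

text \<open>Disjoint subfamilies are independent as random elements of product spaces, and
  measurable functionals preserve this. By \<open>restr\<close> each \<open>f j\<close> reads only
  its own block, so it may be evaluated at the whole family.\<close>

lemma indep_vars_blocks:
  assumes "disjoint_family_on K L" "\<And>j. j \<in> L \<Longrightarrow> K j \<subseteq> J"
    and meas: "\<And>j. j \<in> L \<Longrightarrow> f j \<in> borel_measurable (Pi\<^sub>M (K j) (\<lambda>_. borel))"
    and restr: "\<And>j x. j \<in> L \<Longrightarrow> f j (restrict x (K j)) = f j x"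
  shows "indep_vars (\<lambda>_. borel) (\<lambda>j \<omega>. f j (\<lambda>i. X i \<omega>)) L"
proof -
  have "indep_vars (\<lambda>j. Pi\<^sub>M (K j) (\<lambda>_. borel)) (\<lambda>j \<omega>. restrict (\<lambda>i. X i \<omega>) (K j)) L"
    using assms by (intro indep_vars_restrict[OF indep])
  then have "indep_vars (\<lambda>_. borel) (\<lambda>j \<omega>. f j (restrict (\<lambda>i. X i \<omega>) (K j))) L"
    by (rule indep_vars_compose2) (rule meas)
  then show ?thesis
    by (rule indep_vars_cong[THEN iffD1, rotated -1]) (auto simp: restr)
qed

section \<open>Sums over disjoint blocks of equal size\<close>

context
  fixes K :: "'j \<Rightarrow> 'i set" and L :: "'j set" and m :: nat
  assumes finite_L: "finite L"
    and disjoint_K: "disjoint_family_on K L"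
    and K_subset: "j \<in> L \<Longrightarrow> K j \<subseteq> J"
    and card_K: "j \<in> L \<Longrightarrow> card (K j) = m"
    and m_pos: "0 < m"
begin

lemma std_indep_block: "j \<in> L \<Longrightarrow> std_indep_family M X (K j) B"
  by (rule std_indep_subfamily[OF K_subset])

lemma block_nonempty: "j \<in> L \<Longrightarrow> K j \<noteq> {}"
  using card_K m_pos by force

text \<open>If the sum reaches \<open>2 * r\<close>, the regular or the irregular part reaches
  \<open>r\<close>. The centered regular parts \<open>R\<close> obey the Chernoff bound, and the
  irregular parts \<open>U\<close>, centered by the opposite shift, obey Chebyshev's.\<close>

lemma prob_sum_block_excess_ge:
  assumes "0 < a" "0 < r" "0 < \<kappa>" "\<kappa> \<le> 1 / 24"
  shows "prob {\<omega> \<in> space M. 2 * r \<le> (\<Sum>j\<in>L. block_excess (\<lambda>i. X i \<omega>) (K j))} \<le>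
    exp (real (card L) * (exp (1 / 8) * (1 + sqrt 2)) * (24 * \<kappa>)\<^sup>2 - \<kappa> * r) +
    real (card L) * (a * sum_sixth_const B + (1 / a\<^sup>2 + 1) * ((2 + B) / real m)) / r\<^sup>2"
proof -
  define V where "V = a * sum_sixth_const B + (1 / a\<^sup>2 + 1) * ((2 + B) / real m)"
  define e where "e j = expectation (\<lambda>\<omega>. regular_excess (\<lambda>i. X i \<omega>) (K j))" for j
  define R where "R j \<omega> = regular_excess (\<lambda>i. X i \<omega>) (K j) - e j" for j \<omega>
  define U where "U j \<omega> = irregular_excess (\<lambda>i. X i \<omega>) (K j) + e j" for j \<omega>
  note meas = std_indep_family.measurable_regular_excess_X[OF std_indep_block]
    std_indep_family.measurable_irregular_excess_X[OF std_indep_block]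
  have measR [measurable]: "random_variable borel (R j)" and measU [measurable]: "random_variable borel (U j)"
    if "j \<in> L" for j
    using meas[OF that] unfolding R_def U_def by measurable
  have indR: "indep_vars (\<lambda>_. borel) R L"
    unfolding R_def regular_excess_def
    by (rule indep_vars_blocks[OF disjoint_K K_subset])
      (auto simp: block_excess_if_mem regular_block_if_mem)
  have indU: "indep_vars (\<lambda>_. borel) U L"
    unfolding U_def irregular_excess_def
    by (rule indep_vars_blocks[OF disjoint_K K_subset])
      (auto simp: block_excess_if_mem regular_block_if_mem)
  \<comment> \<open>The whole excess is centered because the variances are 1, so the means of its
    two parts cancel.\<close>
  have EZ: "expectation (\<lambda>\<omega>. irregular_excess (\<lambda>i. X i \<omega>) (K j)) = - e j" if j: "j \<in> L" for j
  proof -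
    interpret b: std_indep_family M X "K j" B
      by (rule std_indep_block[OF j])
    have "e j + expectation (\<lambda>\<omega>. irregular_excess (\<lambda>i. X i \<omega>) (K j)) = 0"
      using b.integrable_regular_excess b.integrable_irregular_excess
        b.expectation_block_excess[OF block_nonempty[OF j]]
      unfolding e_def by (subst Bochner_Integration.integral_add[symmetric]) (auto simp: regular_plus_irregular_excess)
    then show ?thesis by linarith
  qed
  have "prob {\<omega> \<in> space M. r \<le> (\<Sum>j\<in>L. R j \<omega>)} \<le>
      exp (real (card L) * (exp (1 / 8) * (1 + sqrt 2)) * (\<kappa> / (1 / 24))\<^sup>2 - \<kappa> * r)"
  proof (rule prob_sum_ge_exp[OF finite_L indR _ _ _ _ assms(3,4)])
    fix j assume j: "j \<in> L"
    interpret b: std_indep_family M X "K j" B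
      by (rule std_indep_block[OF j])
    note ne = block_nonempty[OF j]
    show "integrable M (R j)"
      unfolding R_def using b.integrable_regular_excess by simp
    show "expectation (R j) = 0"
      unfolding R_def using b.integrable_regular_excess by (simp add: prob_space e_def)
    show "integrable M (\<lambda>\<omega>. exp (1 / 24 * \<bar>R j \<omega>\<bar>))"
      unfolding R_def e_def by (rule b.integrable_exp_regular_excess[OF ne])
    show "expectation (\<lambda>\<omega>. exp (1 / 24 * \<bar>R j \<omega>\<bar>)) \<le> exp (1 / 8) * (1 + sqrt 2)"
      unfolding R_def e_def by (rule b.expectation_exp_regular_excess_le[OF ne])
  qed
  then have 1: "prob {\<omega> \<in> space M. r \<le> (\<Sum>j\<in>L. R j \<omega>)} \<le>
      exp (real (card L) * (exp (1 / 8) * (1 + sqrt 2)) * (24 * \<kappa>)\<^sup>2 - \<kappa> * r)"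
    by (simp add: mult.commute)
  have 2: "prob {\<omega> \<in> space M. r \<le> \<bar>\<Sum>j\<in>L. U j \<omega>\<bar>} \<le> (\<Sum>j\<in>L. V) / r\<^sup>2"
  proof (rule prob_abs_sum_ge[OF finite_L indU _ _ _ assms(2)])
    fix j assume j: "j \<in> L"
    interpret b: std_indep_family M X "K j" B
      by (rule std_indep_block[OF j])
    note ne = block_nonempty[OF j]
    let ?Z = "\<lambda>\<omega>. irregular_excess (\<lambda>i. X i \<omega>) (K j)"
    have eq: "(\<lambda>\<omega>. (U j \<omega>)\<^sup>2) = (\<lambda>\<omega>. (?Z \<omega>)\<^sup>2 + 2 * e j * ?Z \<omega> + (e j)\<^sup>2)"
      by (auto simp: U_def power2_eq_square algebra_simps)
    note int = b.integrable_irregular_excess b.integrable_irregular_excess_square[OF ne]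
    show "integrable M (\<lambda>\<omega>. (U j \<omega>)\<^sup>2)"
      unfolding eq using int by simp
    show "expectation (U j) = 0"
      unfolding U_def using int EZ[OF j] by (simp add: prob_space)
    \<comment> \<open>Centering only lowers the second moment, so the bound for the uncentered
      irregular excess carries over.\<close>
    have "expectation (\<lambda>\<omega>. (U j \<omega>)\<^sup>2) = expectation (\<lambda>\<omega>. (?Z \<omega>)\<^sup>2) - (e j)\<^sup>2"
      unfolding eq using int EZ[OF j] by (simp add: prob_space power2_eq_square)
    also have "\<dots> \<le> expectation (\<lambda>\<omega>. (?Z \<omega>)\<^sup>2)"
      by simp
    also have "\<dots> \<le> V"
      using b.expectation_irregular_excess_square_le[OF ne assms(1)] card_K[OF j] by (simp add: V_def)
    finally show "expectation (\<lambda>\<omega>. (U j \<omega>)\<^sup>2) \<le> V" .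
  qed
  have eq: "(\<Sum>j\<in>L. block_excess (\<lambda>i. X i \<omega>) (K j)) = (\<Sum>j\<in>L. R j \<omega>) + (\<Sum>j\<in>L. U j \<omega>)" for \<omega>
    unfolding sum.distrib[symmetric] R_def U_def
    by (simp add: regular_plus_irregular_excess[symmetric] algebra_simps)
  have "prob {\<omega> \<in> space M. 2 * r \<le> (\<Sum>j\<in>L. block_excess (\<lambda>i. X i \<omega>) (K j))} \<le>
      prob ({\<omega> \<in> space M. r \<le> (\<Sum>j\<in>L. R j \<omega>)} \<union> {\<omega> \<in> space M. r \<le> \<bar>\<Sum>j\<in>L. U j \<omega>\<bar>})"
    unfolding eq by (intro finite_measure_mono) auto
  also have "\<dots> \<le> prob {\<omega> \<in> space M. r \<le> (\<Sum>j\<in>L. R j \<omega>)} + prob {\<omega> \<in> space M. r \<le> \<bar>\<Sum>j\<in>L. U j \<omega>\<bar>}"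
    by (intro measure_Un_le) auto
  finally show ?thesis
    using 1 2 unfolding V_def by simp
qed

text \<open>Expanding the squares gives the total shift \<open>D\<close> plus the centered
  independent terms \<open>T\<close>, consisting of an excess and a linear part. Falling to
  \<open>D / 2\<close> is a deviation of their sum by \<open>D / 2\<close>, bounded by
  Chebyshev.\<close>

lemma prob_shifted_sum_le:
  fixes d :: "'j \<Rightarrow> real"
  defines "D \<equiv> \<Sum>j\<in>L. (d j)\<^sup>2"
  assumes D: "0 < D"
  shows "prob {\<omega> \<in> space M. (\<Sum>j\<in>L. ((\<Sum>i\<in>K j. X i \<omega>) / sqrt (real m) + d j)\<^sup>2 - 1) \<le> D / 2} \<le>
    4 * (2 * real (card L) * (sum_sixth_const B + 2) + 8 * D) / D\<^sup>2"
proof -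
  define T where "T j \<omega> = block_excess (\<lambda>i. X i \<omega>) (K j) + 2 * d j / sqrt (real m) * (\<Sum>i\<in>K j. X i \<omega>)" for j \<omega>
  have rv [measurable]: "random_variable borel (T j)" if j: "j \<in> L" for j
  proof -
    interpret b: std_indep_family M X "K j" B
      by (rule std_indep_block[OF j])
    show ?thesis
      using b.random_variable_X unfolding T_def by measurable
  qed
  have ind: "indep_vars (\<lambda>_. borel) T L"
    unfolding T_def
    by (rule indep_vars_blocks[OF disjoint_K K_subset]) (auto simp: block_excess_if_mem)
  have "prob {\<omega> \<in> space M. D / 2 \<le> \<bar>\<Sum>j\<in>L. T j \<omega>\<bar>} \<le>
      (\<Sum>j\<in>L. 2 * (sum_sixth_const B + 2) + 8 * (d j)\<^sup>2) / (D / 2)\<^sup>2"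
  proof (rule prob_abs_sum_ge[OF finite_L ind])
    show "0 < D / 2"
      using D by simp
    fix j assume j: "j \<in> L"
    interpret b: std_indep_family M X "K j" B
      by (rule std_indep_block[OF j])
    note ne = block_nonempty[OF j]
    let ?e = "\<lambda>\<omega>. block_excess (\<lambda>i. X i \<omega>) (K j)" and ?S = "\<lambda>\<omega>. \<Sum>i\<in>K j. X i \<omega>"
    let ?c = "2 * d j / sqrt (real m)"
    let ?h = "\<lambda>\<omega>. 2 * (?e \<omega>)\<^sup>2 + 2 * (?c\<^sup>2 * (?S \<omega>)\<^sup>2)"
    \<comment> \<open>Doubling both squares avoids the covariance between the excess and the linear
      part.\<close>
    have le: "(T j \<omega>)\<^sup>2 \<le> ?h \<omega>" for \<omega>
      using sum_squares_bound[of "?e \<omega>" "?c * ?S \<omega>"]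
      by (simp only: T_def power2_sum power_mult_distrib)
    have inth: "integrable M ?h"
      using b.integrable_block_excess_square[OF ne] b.integrable_sum_square by simp
    show int: "integrable M (\<lambda>\<omega>. (T j \<omega>)\<^sup>2)"
    proof (rule Bochner_Integration.integrable_bound[OF inth])
      show "AE \<omega> in M. norm ((T j \<omega>)\<^sup>2) \<le> norm (?h \<omega>)"
        using le by (intro AE_I2) (simp add: abs_of_nonneg)
    qed (use j in measurable)
    have "expectation (T j) = expectation ?e + ?c * expectation ?S"
      unfolding T_def using b.integrable_block_excess b.integrable_sum
      by (subst Bochner_Integration.integral_add) auto
    then show "expectation (T j) = 0"
      using b.expectation_block_excess[OF ne] b.expectation_sum by simp
    have "expectation (\<lambda>\<omega>. (T j \<omega>)\<^sup>2) \<le> expectation ?h"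
      by (intro integral_mono int inth le)
    also have "\<dots> = 2 * expectation (\<lambda>\<omega>. (?e \<omega>)\<^sup>2) + 2 * (?c\<^sup>2 * real m)"
      using b.integrable_block_excess_square[OF ne] b.integrable_sum_square b.expectation_sum_square card_K[OF j]
      by simp
    also have "?c\<^sup>2 * real m = 4 * (d j)\<^sup>2"
      using m_pos by (simp add: power_divide power_mult_distrib)
    also have "2 * expectation (\<lambda>\<omega>. (?e \<omega>)\<^sup>2) + 2 * (4 * (d j)\<^sup>2) \<le> 2 * (sum_sixth_const B + 2) + 8 * (d j)\<^sup>2"
      using mult_left_mono[OF b.expectation_block_excess_square_le[OF ne], of 2] by simp
    finally show "expectation (\<lambda>\<omega>. (T j \<omega>)\<^sup>2) \<le> 2 * (sum_sixth_const B + 2) + 8 * (d j)\<^sup>2" .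
  qed
  also have "\<dots> = 4 * (2 * real (card L) * (sum_sixth_const B + 2) + 8 * D) / D\<^sup>2"
    by (simp add: sum.distrib sum_distrib_left[symmetric] D_def power_divide algebra_simps)
  finally have *: "prob {\<omega> \<in> space M. D / 2 \<le> \<bar>\<Sum>j\<in>L. T j \<omega>\<bar>} \<le>
      4 * (2 * real (card L) * (sum_sixth_const B + 2) + 8 * D) / D\<^sup>2" .
  have eq: "(\<Sum>j\<in>L. ((\<Sum>i\<in>K j. X i \<omega>) / sqrt (real m) + d j)\<^sup>2 - 1) = (\<Sum>j\<in>L. T j \<omega>) + D" for \<omega>
    unfolding D_def sum.distrib[symmetric]
    by (rule sum.cong) (auto simp: T_def block_excess_def card_K power2_sum power_divide)
  have "prob {\<omega> \<in> space M. (\<Sum>j\<in>L. ((\<Sum>i\<in>K j. X i \<omega>) / sqrt (real m) + d j)\<^sup>2 - 1) \<le> D / 2} \<le>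
      prob {\<omega> \<in> space M. D / 2 \<le> \<bar>\<Sum>j\<in>L. T j \<omega>\<bar>}"
    unfolding eq by (intro finite_measure_mono) auto
  then show ?thesis
    using * by linarith
qed

end

end

section \<open>The change-point model\<close>

lemma power_le_const_mult_exp:
  fixes u :: real
  assumes "0 \<le> u"
  shows "u ^ N \<le> real N ^ N * exp u"
proof (cases "N = 0")
  case False
  have "u / real N \<le> exp (u / real N)"
    using exp_ge_add_one_self[of "u / real N"] by linarith
  then have "(u / real N) ^ N \<le> exp (u / real N) ^ N"
    using assms by (intro power_mono) auto
  also have "\<dots> = exp u"
    using False by (simp add: exp_of_nat_mult[symmetric])
  finally show ?thesis
    using False by (simp add: power_divide field_simps)
qed (use assms in simp)

text \<open>In terms of \<open>u = \<bar>w / K\<bar> powr \<alpha>\<close> the sixth power of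
  \<open>w / K\<close> is \<open>u powr (6 / \<alpha>)\<close>; for \<open>u > 1\<close> the
  exponent is raised to the integer \<open>N\<close>, and the exponential dominates
  \<open>u ^ N\<close>.\<close>

lemma sixth_power_le_exp_powr:
  fixes \<alpha> K w :: real
  assumes "0 < \<alpha>" "0 < K" "6 / \<alpha> \<le> real N"
  shows "w ^ 6 \<le> K ^ 6 * (1 + real N ^ N * exp (\<bar>w / K\<bar> powr \<alpha>))"
proof -
  define u where "u = \<bar>w / K\<bar> powr \<alpha>"
  have u: "0 \<le> u" by (simp add: u_def)
  have "(w / K) ^ 6 = \<bar>w / K\<bar> ^ 6"
    by (simp add: power_even_abs del: abs_divide)
  also have "\<dots> = \<bar>w / K\<bar> powr 6"
    by (cases "w = 0") (auto simp: powr_realpow[symmetric] assms)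
  also have "\<dots> = u powr (6 / \<alpha>)"
    using assms by (simp add: u_def powr_powr)
  also have "\<dots> \<le> 1 + u ^ N"
  proof (cases "u \<le> 1")
    case True
    then have "u powr (6 / \<alpha>) \<le> 1"
      using assms u by (intro powr_le1) auto
    then show ?thesis
      using u by (smt (verit) zero_le_power)
  next
    case False
    then have "u powr (6 / \<alpha>) \<le> u powr real N"
      using assms by (intro powr_mono) auto
    then show ?thesis
      using False by (simp add: powr_realpow)
  qed
  also have "\<dots> \<le> 1 + real N ^ N * exp u"
    using power_le_const_mult_exp[OF u] by simp
  finally have "K ^ 6 * (w / K) ^ 6 \<le> K ^ 6 * (1 + real N ^ N * exp u)"
    using assms by (intro mult_left_mono) auto
  then show ?thesis
    using assms by (simp add: u_def power_divide)
qed

text \<open>Integrates the pointwise bound against the exponential moment bound 2 of the class. Only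
  through this \<open>B\<close> do \<open>\<alpha>\<close> and \<open>K\<close> enter the constants
  of the theorem.\<close>

lemma noise_class_sixth_moment:
  fixes \<alpha> K :: real
  assumes "0 < \<alpha>" "0 < K"
  shows "\<exists>B\<ge>0. \<forall>D\<in>noise_class \<alpha> K. integrable D (\<lambda>w. w ^ 6) \<and> (LINT w|D. w ^ 6) \<le> B"
proof -
  define N where "N = nat \<lceil>6 / \<alpha>\<rceil>"
  have N: "6 / \<alpha> \<le> real N"
    unfolding N_def by linarith
  define B where "B = K ^ 6 * (1 + real N ^ N * 2)"
  have "integrable D (\<lambda>w. w ^ 6) \<and> (LINT w|D. w ^ 6) \<le> B" if D: "D \<in> noise_class \<alpha> K" for D
  proof -
    interpret real_distribution D
      using D by (simp add: noise_class_def)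
    have "(\<integral>\<^sup>+w. ennreal (w ^ 6) \<partial>D) \<le>
        (\<integral>\<^sup>+w. ennreal (K ^ 6) * (1 + ennreal (real N ^ N) * ennreal (exp (\<bar>w / K\<bar> powr \<alpha>))) \<partial>D)"
    proof (rule nn_integral_mono)
      fix w :: real
      have "ennreal (w ^ 6) \<le> ennreal (K ^ 6 * (1 + real N ^ N * exp (\<bar>w / K\<bar> powr \<alpha>)))"
        by (intro ennreal_leI sixth_power_le_exp_powr assms N)
      also have "\<dots> = ennreal (K ^ 6) * (1 + ennreal (real N ^ N) * ennreal (exp (\<bar>w / K\<bar> powr \<alpha>)))"
        using assms by (simp add: ennreal_mult)
      finally show "ennreal (w ^ 6) \<le> ennreal (K ^ 6) * (1 + ennreal (real N ^ N) * ennreal (exp (\<bar>w / K\<bar> powr \<alpha>)))" .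
    qed
    also have "\<dots> = ennreal (K ^ 6) * (1 + ennreal (real N ^ N) * (\<integral>\<^sup>+w. ennreal (exp (\<bar>w / K\<bar> powr \<alpha>)) \<partial>D))"
      using emeasure_space_1 by (simp add: nn_integral_cmult nn_integral_add)
    also have "\<dots> \<le> ennreal (K ^ 6) * (1 + ennreal (real N ^ N) * 2)"
      using D by (intro mult_left_mono add_left_mono) (auto simp: noise_class_def)
    also have "\<dots> = ennreal B"
      using assms unfolding B_def
      by (simp add: ennreal_mult)
    finally have le: "(\<integral>\<^sup>+w. ennreal (w ^ 6) \<partial>D) \<le> ennreal B" .
    have int: "integrable D (\<lambda>w. w ^ 6)"
      using le by (intro integrableI_nonneg) (auto simp: less_top[symmetric] top_unique)
    have "ennreal (LINT w|D. w ^ 6) \<le> ennreal B"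
      using le nn_integral_eq_integral[OF int] by simp
    then show ?thesis
      using int assms by (simp add: B_def ennreal_le_iff)
  qed
  moreover have "0 \<le> B"
    using assms by (simp add: B_def)
  ultimately show ?thesis by blast
qed

text \<open>Signs preserve independence, vanishing means, and second and sixth moments. With them a
  contrast becomes a plain sum, to which the bounds for blocks apply.\<close>

lemma joint_noise_std_indep_family:
  assumes P: "P \<in> joint_noise_class \<alpha> K p n"
    and B: "0 \<le> B" "\<And>D. D \<in> noise_class \<alpha> K \<Longrightarrow> integrable D (\<lambda>w. w ^ 6)"
      "\<And>D. D \<in> noise_class \<alpha> K \<Longrightarrow> (LINT w|D. w ^ 6) \<le> B"
    and s: "\<And>i. \<bar>s i\<bar> = (1::real)"
  shows "std_indep_family P (\<lambda>i E. s i * E i) (mat_index p n) B"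
proof -
  interpret prob_space P
    using P by (simp add: joint_noise_class_def)
  have ind: "indep_vars (\<lambda>_. borel) (\<lambda>i E. E i) (mat_index p n)"
    and noise: "\<And>i. i \<in> mat_index p n \<Longrightarrow> distr P borel (\<lambda>E. E i) \<in> noise_class \<alpha> K"
    using P by (auto simp: joint_noise_class_def)
  have rv [measurable]: "random_variable borel (\<lambda>E. E i)" if "i \<in> mat_index p n" for i
    using ind that by (auto simp: indep_vars_def)
  have s2: "(s i)\<^sup>2 = 1" for i
    using s[of i] by (metis abs_1 power2_abs power_one)
  have s6: "s i ^ 6 = 1" for i
    using power_mult[of "s i" 2 3] s2[of i] by simp
  show ?thesis
  proof unfold_locales
    show "finite (mat_index p n)"
      by (simp add: mat_index_def)
    show "indep_vars (\<lambda>_. borel) (\<lambda>i E. s i * E i) (mat_index p n)"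
      by (rule indep_vars_compose2[OF ind]) auto
    show "0 \<le> B" by (rule B)
    fix i assume i: "i \<in> mat_index p n"
    note noise_i = noise[OF i]
    have exp_distr: "expectation (\<lambda>E. f (E i)) = (LINT w|distr P borel (\<lambda>E. E i). f w)"
      if "f \<in> borel_measurable borel" for f :: "real \<Rightarrow> real"
      using that rv[OF i] by (subst integral_distr) auto
    show "expectation (\<lambda>E. s i * E i) = 0"
      using noise_i exp_distr[of "\<lambda>w. w"] by (simp add: noise_class_def)
    show "expectation (\<lambda>E. (s i * E i)\<^sup>2) = 1"
      using noise_i exp_distr[of "\<lambda>w. w\<^sup>2"] s2[of i] by (simp add: noise_class_def power_mult_distrib)
    show "integrable P (\<lambda>E. (s i * E i) ^ 6)"
      using B(2)[OF noise_i] rv[OF i] s6[of i] by (simp add: integrable_distr_eq power_mult_distrib)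
    show "expectation (\<lambda>E. (s i * E i) ^ 6) \<le> B"
      using B(3)[OF noise_i] exp_distr[of "\<lambda>w. w ^ 6"] s6[of i] by (simp add: power_mult_distrib)
  qed
qed

section \<open>Contrasts as signed sums over blocks\<close>

definition contrast_sign :: "nat \<Rightarrow> nat \<times> nat \<Rightarrow> real" where
  "contrast_sign t i = (if snd i \<le> t then 1 else - 1)"

text \<open>The entries of row \<open>j\<close> read by the statistic at scale \<open>t\<close>. For
  \<open>2 * t \<le> n\<close> the two ends are disjoint and the block has \<open>2 * t\<close>
  elements; blocks of different rows are always disjoint.\<close>

definition contrast_block :: "nat \<Rightarrow> nat \<Rightarrow> nat \<Rightarrow> (nat \<times> nat) set" where
  "contrast_block n t j = {j} \<times> ({1..t} \<union> {n + 1 - t..n})"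

lemma sum_contrast_block:
  assumes "2 * t \<le> n"
  shows "(\<Sum>i\<in>contrast_block n t j. contrast_sign t i * x i) =
    (\<Sum>i=1..t. x (j, i)) - (\<Sum>i=1..t. x (j, n + 1 - i))"
proof -
  have "(\<Sum>i\<in>contrast_block n t j. contrast_sign t i * x i) =
      (\<Sum>i\<in>{1..t} \<union> {n + 1 - t..n}. contrast_sign t (j, i) * x (j, i))"
    unfolding contrast_block_def
    by (rule sum.reindex_bij_witness[of _ "\<lambda>i. (j, i)" snd]) auto
  also have "\<dots> = (\<Sum>i\<in>{1..t}. contrast_sign t (j, i) * x (j, i)) +
      (\<Sum>i\<in>{n + 1 - t..n}. contrast_sign t (j, i) * x (j, i))"
    using assms by (intro sum.union_disjoint) auto
  also have "(\<Sum>i\<in>{1..t}. contrast_sign t (j, i) * x (j, i)) = (\<Sum>i=1..t. x (j, i))"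
    by (intro sum.cong) (auto simp: contrast_sign_def)
  also have "(\<Sum>i\<in>{n + 1 - t..n}. contrast_sign t (j, i) * x (j, i)) = (\<Sum>i\<in>{n + 1 - t..n}. - x (j, i))"
    using assms by (intro sum.cong) (auto simp: contrast_sign_def)
  also have "\<dots> = - (\<Sum>i=1..t. x (j, n + 1 - i))"
    unfolding sum_negf using assms
    by (subst sum.reindex_bij_witness[of _ "\<lambda>i. n + 1 - i" "\<lambda>i. n + 1 - i"]) auto
  finally show ?thesis by simp
qed

lemma card_contrast_block:
  assumes "2 * t \<le> n"
  shows "card (contrast_block n t j) = 2 * t"
proof -
  have "card ({1..t} \<union> {n + 1 - t..n}) = card {1..t} + card {n + 1 - t..n}"
    using assms by (intro card_Un_disjoint) auto
  then show ?thesis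
    using assms by (simp add: contrast_block_def card_cartesian_product)
qed

lemma contrast_block_subset: "2 * t \<le> n \<Longrightarrow> j \<in> {1..p} \<Longrightarrow> contrast_block n t j \<subseteq> mat_index p n"
  by (auto simp: contrast_block_def mat_index_def)

lemma disjoint_contrast_block: "disjoint_family_on (contrast_block n t) L"
  by (auto simp: disjoint_family_on_def contrast_block_def)

lemma Y_stat_eq:
  assumes "2 * t \<le> n"
  shows "Y_stat n x t j = (\<Sum>i\<in>contrast_block n t j. contrast_sign t i * x i) / sqrt (real (2 * t))"
  by (simp add: Y_stat_def sum_contrast_block[OF assms])

lemma Y_stat_mat_add:
  assumes "2 * t \<le> n" "j \<in> {1..p}"
  shows "Y_stat n (mat_add p n \<theta> E) t j = Y_stat n E t j + Y_stat n \<theta> t j"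
proof -
  have "(\<Sum>i\<in>contrast_block n t j. contrast_sign t i * mat_add p n \<theta> E i) =
      (\<Sum>i\<in>contrast_block n t j. contrast_sign t i * E i + contrast_sign t i * \<theta> i)"
    using contrast_block_subset[OF assms]
    by (intro sum.cong) (auto simp: mat_add_def algebra_simps)
  then show ?thesis
    by (simp add: Y_stat_eq[OF assms(1)] sum.distrib add_divide_distrib)
qed

lemma Y_stat_null:
  assumes "\<theta> \<in> null_params p n" "2 * t \<le> n" "j \<in> {1..p}"
  shows "Y_stat n \<theta> t j = 0"
proof -
  obtain \<mu> where \<mu>: "\<forall>t\<in>{1..n}. \<forall>j\<in>{1..p}. \<theta> (j, t) = \<mu> j"
    using assms(1) by (auto simp: null_params_def)
  have "(\<Sum>i=1..t. \<theta> (j, i)) = (\<Sum>i=1..t. \<mu> j)"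
    using \<mu> assms by (intro sum.cong) auto
  moreover have "(\<Sum>i=1..t. \<theta> (j, n + 1 - i)) = (\<Sum>i=1..t. \<mu> j)"
  proof (intro sum.cong refl)
    fix i assume "i \<in> {1..t}"
    then have "n + 1 - i \<in> {1..n}"
      using assms(2) by auto
    then show "\<theta> (j, n + 1 - i) = \<mu> j"
      using \<mu> assms(3) by blast
  qed
  ultimately show ?thesis by (simp add: Y_stat_def)
qed

lemma A_stat_null:
  assumes "\<theta> \<in> null_params p n" "2 * t \<le> n"
  shows "A_stat p n (mat_add p n \<theta> E) t =
    (\<Sum>j\<in>{1..p}. block_excess (\<lambda>i. contrast_sign t i * E i) (contrast_block n t j))"
proof -
  have "(Y_stat n (mat_add p n \<theta> E) t j)\<^sup>2 - 1 =
      block_excess (\<lambda>i. contrast_sign t i * E i) (contrast_block n t j)" if j: "j \<in> {1..p}" for j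
  proof -
    have "(Y_stat n E t j)\<^sup>2 - 1 = block_excess (\<lambda>i. contrast_sign t i * E i) (contrast_block n t j)"
      by (simp add: Y_stat_eq[OF assms(2)] block_excess_def card_contrast_block[OF assms(2)] power_divide
          del: of_nat_mult)
    then show ?thesis
      by (simp add: Y_stat_mat_add[OF assms(2) j] Y_stat_null[OF assms j])
  qed
  then show ?thesis by (simp add: A_stat_def)
qed

lemma A_stat_mat_add:
  assumes "2 * t \<le> n"
  shows "A_stat p n (mat_add p n \<theta> E) t = (\<Sum>j\<in>{1..p}.
    ((\<Sum>i\<in>contrast_block n t j. contrast_sign t i * E i) / sqrt (real (2 * t)) + Y_stat n \<theta> t j)\<^sup>2 - 1)"
  unfolding A_stat_def
  by (intro sum.cong refl) (simp only: Y_stat_mat_add[OF assms] Y_stat_eq[OF assms, of E])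

section \<open>Size of the iterated logarithm and dyadic scales\<close>

lemma ln_ln_ge_half:
  assumes "(2::nat) \<le> n"
  shows "1 / 2 \<le> ln (ln (8 * real n))"
proof -
  \<comment> \<open>For \<open>n \<ge> 2\<close> the argument is at least 16 = \<open>2 ^ 4\<close>,
    whose logarithm exceeds 2; then \<open>ln 2 \<ge> 2 / 3\<close> is more than enough.\<close>
  have "ln (2 ^ 4) = 4 * ln (2::real)"
    by (subst ln_realpow) auto
  then have "2 \<le> ln (16::real)"
    using ln2_ge_two_thirds by simp
  also have "\<dots> \<le> ln (8 * real n)"
    using assms by (intro ln_mono) auto
  finally have "ln 2 \<le> ln (ln (8 * real n))"
    by (intro ln_mono) auto
  then show ?thesis
    using ln2_ge_two_thirds by linarith
qed

text \<open>The number of scales is at most \<open>ln n / ln 2\<close>. It is written as an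
  exponential of the iterated logarithm so that the union bound merely adds 1 to the
  exponent.\<close>

lemma card_dyadic_exponents_le:
  assumes "2 \<le> n"
  shows "real (card {0..nat \<lfloor>log 2 (real n / 2)\<rfloor>}) \<le> 2 * exp (ln (ln (8 * real n)))"
proof -
  have n: "1 < 8 * real n" using assms by simp
  have "0 \<le> log 2 (real n / 2)"
    using assms by simp
  then have "real (card {0..nat \<lfloor>log 2 (real n / 2)\<rfloor>}) \<le> log 2 (real n / 2) + 1"
    by simp
  also have "\<dots> = ln (real n) / ln 2"
    using assms by (simp add: log_def ln_div field_simps)
  also have "\<dots> \<le> ln (8 * real n) / ln 2"
    using assms by (intro divide_right_mono ln_mono) auto
  also have "\<dots> \<le> ln (8 * real n) / (1 / 2)"
    using ln2_ge_two_thirds n by (intro divide_left_mono) auto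
  also have "\<dots> = 2 * exp (ln (ln (8 * real n)))"
    using n by simp
  finally show ?thesis .
qed

lemma ex_dyadic_scale:
  assumes "1 \<le> k" "2 * k \<le> n"
  obtains t where "t \<in> dyadic_grid n" "t \<le> k" "k < 2 * t"
proof -
  obtain e where e: "2 ^ e \<le> k" "k < 2 ^ (e + 1)"
    using ex_power_ivl1[of 2 k] assms by auto
  have "real (2 ^ e) \<le> real n / 2"
    using e(1) assms(2) by linarith
  then have "real e \<le> log 2 (real n / 2)"
    using assms by (simp add: le_log_iff powr_realpow)
  then have "e \<le> nat \<lfloor>log 2 (real n / 2)\<rfloor>"
    by linarith
  then have "2 ^ e \<in> dyadic_grid n"
    by (auto simp: dyadic_grid_def)
  then show ?thesis
    using e by (intro that) auto
qed

text \<open>At a scale \<open>t \<le> k\<close> neither end of the contrast crosses the change, so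
  the shift has energy \<open>t / 2\<close> times the squared jump. As \<open>k < 2 * t\<close>, the
  signal is at most \<open>2 * t\<close> times the squared jump, whence the factor 4.\<close>

lemma alt_shift_ge:
  assumes \<theta>: "\<theta> \<in> alt_params p n s \<rho>"
  obtains t where "t \<in> dyadic_grid n" "\<rho>\<^sup>2 / 4 \<le> (\<Sum>j\<in>{1..p}. (Y_stat n \<theta> t j)\<^sup>2)"
proof -
  obtain t0 where t0: "t0 \<in> {1..n - 1}" and \<theta>': "\<theta> \<in> alt_params_at p n s \<rho> t0"
    using \<theta> by (auto simp: alt_params_def)
  obtain \<mu>1 \<mu>2 where
    \<mu>: "\<forall>t\<in>{1..n}. \<forall>j\<in>{1..p}. \<theta> (j, t) = (if t \<le> t0 then \<mu>1 j else \<mu>2 j)"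
    and \<rho>: "\<rho>\<^sup>2 \<le> real t0 * (real n - real t0) / real n * (L2_set (\<lambda>j. \<mu>1 j - \<mu>2 j) {1..p})\<^sup>2"
    using \<theta>' unfolding alt_params_at_def by blast
  define k where "k = min t0 (n - t0)"
  have "1 \<le> k" "2 * k \<le> n"
    using t0 by (auto simp: k_def)
  then obtain t where t: "t \<in> dyadic_grid n" "t \<le> k" "k < 2 * t"
    by (rule ex_dyadic_scale)
  have tn: "2 * t \<le> n" and tpos: "1 \<le> t"
    using t \<open>2 * k \<le> n\<close> by auto
  let ?\<Delta> = "\<Sum>j\<in>{1..p}. (\<mu>1 j - \<mu>2 j)\<^sup>2"
  have \<Delta>: "(L2_set (\<lambda>j. \<mu>1 j - \<mu>2 j) {1..p})\<^sup>2 = ?\<Delta>"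
    by (simp add: L2_set_def sum_nonneg)
  have "(Y_stat n \<theta> t j)\<^sup>2 = real t / 2 * (\<mu>1 j - \<mu>2 j)\<^sup>2" if j: "j \<in> {1..p}" for j
  proof -
    have "(\<Sum>i=1..t. \<theta> (j, i)) = (\<Sum>i=1..t. \<mu>1 j)"
      using \<mu> j t t0 by (intro sum.cong) (auto simp: k_def)
    moreover have "(\<Sum>i=1..t. \<theta> (j, n + 1 - i)) = (\<Sum>i=1..t. \<mu>2 j)"
    proof (intro sum.cong refl)
      fix i assume "i \<in> {1..t}"
      then have "n + 1 - i \<in> {1..n}" "\<not> n + 1 - i \<le> t0"
        using t t0 tn by (auto simp: k_def)
      then show "\<theta> (j, n + 1 - i) = \<mu>2 j"
        using \<mu> j by metis
    qed
    ultimately have "Y_stat n \<theta> t j = real t * (\<mu>1 j - \<mu>2 j) / sqrt (2 * real t)"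
      by (simp add: Y_stat_def algebra_simps)
    then have "(Y_stat n \<theta> t j)\<^sup>2 = (real t * (\<mu>1 j - \<mu>2 j))\<^sup>2 / (2 * real t)"
      by (simp add: power_divide del: real_sqrt_mult)
    then show ?thesis
      using tpos by (simp add: power2_eq_square)
  qed
  then have D: "(\<Sum>j\<in>{1..p}. (Y_stat n \<theta> t j)\<^sup>2) = real t / 2 * ?\<Delta>"
    unfolding sum_distrib_left by (intro sum.cong refl)
  \<comment> \<open>The smaller of the two segment lengths is multiplied by the larger one divided
    by \<open>n\<close>, a factor of at most 1.\<close>
  have "real t0 * (real n - real t0) / real n \<le> real k"
  proof (cases "t0 \<le> n - t0")
    case True
    then have "k = t0" by (simp add: k_def)
    then show ?thesis
      using t0 by (simp add: divide_le_eq mult_left_mono)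
  next
    case False
    then have "real k = real n - real t0"
      using t0 by (simp add: k_def of_nat_diff)
    then show ?thesis
      using t0 by (simp add: divide_le_eq mult.commute mult_right_mono)
  qed
  also have "\<dots> \<le> 2 * real t"
    using t by linarith
  finally have "real t0 * (real n - real t0) / real n * ?\<Delta> \<le> 2 * real t * ?\<Delta>"
    by (intro mult_right_mono sum_nonneg) auto
  then have "\<rho>\<^sup>2 \<le> 2 * real t * ?\<Delta>"
    using \<rho> unfolding \<Delta> by linarith
  then have "\<rho>\<^sup>2 / 4 \<le> (\<Sum>j\<in>{1..p}. (Y_stat n \<theta> t j)\<^sup>2)"
    unfolding D by simp
  then show ?thesis
    using t(1) that by blast
qed

section \<open>Null deviations at the rate of the test\<close>

definition mgf_const :: real where
  "mgf_const = exp (1 / 8) * (1 + sqrt 2)"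

text \<open>The two-part bound at the threshold of the test. Tuning \<open>\<kappa>\<close> turns
  the exponential part into a power of \<open>exp l\<close>, tuning \<open>a\<close> makes the
  Chebyshev part geometric in \<open>k\<close>, and neither bound depends on \<open>p\<close> any
  more.\<close>

lemma (in std_indep_family) prob_sum_block_excess_gt_rate:
  assumes L: "finite L" "disjoint_family_on K L" "\<And>j. j \<in> L \<Longrightarrow> K j \<subseteq> J"
    and card_K: "\<And>j. j \<in> L \<Longrightarrow> card (K j) = 2 * 2 ^ k"
    and p: "p = real (card L)" "0 < p" and l: "1 / 2 \<le> l" and C: "0 < C"
  shows "prob {\<omega> \<in> space M. C * (sqrt (p * l) + l) < (\<Sum>j\<in>L. block_excess (\<lambda>i. X i \<omega>) (K j))} \<le>
    exp ((mgf_const - C / 48) * l) + 8 * (sum_sixth_const B + 2 + B) * (8 / 9) ^ k / C\<^sup>2"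
proof -
  define r where "r = C / 2 * (sqrt (p * l) + l)"
  \<comment> \<open>Bernstein's two regimes: \<open>sqrt (l / p)\<close> balances the quadratic and
    linear terms of the exponent, and the cap 1 is the limit
    \<open>\<kappa> \<le> 1 / 24\<close>.\<close>
  define \<theta> where "\<theta> = min 1 (sqrt (l / p))"
  define \<kappa> where "\<kappa> = \<theta> / 24"
  \<comment> \<open>The choice is \<open>a = (3 / 4) ^ k\<close>: then \<open>a\<close> and
    \<open>1 / (a\<^sup>2 * 2 ^ k)\<close>, which equals \<open>(8 / 9) ^ k\<close>, both decay
    geometrically.\<close>
  define V where "V = (3 / 4) ^ k * sum_sixth_const B +
    (1 / ((3 / 4) ^ k)\<^sup>2 + 1) * ((2 + B) / real (2 * 2 ^ k))"
  have pl: "0 < p * l" using p l by simp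
  have r: "0 < r"
    using C p l by (simp add: r_def add_nonneg_pos)
  have \<theta>: "0 < \<theta>" "\<theta> \<le> 1"
    using p l by (auto simp: \<theta>_def)
  have "prob {\<omega> \<in> space M. C * (sqrt (p * l) + l) < (\<Sum>j\<in>L. block_excess (\<lambda>i. X i \<omega>) (K j))} \<le>
      prob {\<omega> \<in> space M. 2 * r \<le> (\<Sum>j\<in>L. block_excess (\<lambda>i. X i \<omega>) (K j))}"
  proof (rule finite_measure_mono)
    have "(\<lambda>\<omega>. block_excess (\<lambda>i. X i \<omega>) (K j)) \<in> borel_measurable M" if "j \<in> L" for j
      by (rule std_indep_family.measurable_block_excess_X[OF std_indep_subfamily[OF L(3)[OF that]]])
    then show "{\<omega> \<in> space M. 2 * r \<le> (\<Sum>j\<in>L. block_excess (\<lambda>i. X i \<omega>) (K j))} \<in> sets M"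
      by measurable
  qed (auto simp: r_def)
  also have "\<dots> \<le> exp (p * mgf_const * (24 * \<kappa>)\<^sup>2 - \<kappa> * r) + p * V / r\<^sup>2"
    unfolding V_def p(1) mgf_const_def
    by (rule prob_sum_block_excess_ge) (use L card_K r \<theta> in \<open>auto simp: \<kappa>_def\<close>)
  also have "\<dots> \<le> exp ((mgf_const - C / 48) * l) + 8 * (sum_sixth_const B + 2 + B) * (8 / 9) ^ k / C\<^sup>2"
  proof (rule add_mono)
    have 1: "p * \<theta>\<^sup>2 \<le> l"
    proof -
      have "\<theta>\<^sup>2 \<le> (sqrt (l / p))\<^sup>2"
        using \<theta> by (intro power_mono) (auto simp: \<theta>_def)
      then show ?thesis
        using p l by (simp add: field_simps)
    qed
    \<comment> \<open>When \<open>\<theta> = 1\<close> the summand \<open>l\<close> suffices;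
      otherwise \<open>\<theta> * sqrt (p * l)\<close> equals \<open>l\<close>.\<close>
    have 2: "l \<le> \<theta> * (sqrt (p * l) + l)"
    proof (cases "1 \<le> sqrt (l / p)")
      case True
      then show ?thesis
        using pl by (simp add: \<theta>_def)
    next
      case False
      have "sqrt (l / p) * sqrt (p * l) = sqrt (l\<^sup>2)"
        unfolding real_sqrt_mult[symmetric] using p by (simp add: power2_eq_square)
      then have "\<theta> * sqrt (p * l) = l"
        using False l by (simp add: \<theta>_def)
      then show ?thesis
        using \<theta> l by (simp add: distrib_left)
    qed
    have "mgf_const * (p * \<theta>\<^sup>2) \<le> mgf_const * l"
      using 1 by (intro mult_left_mono) (auto simp: mgf_const_def)
    moreover have "C / 48 * l \<le> C / 48 * (\<theta> * (sqrt (p * l) + l))"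
      using 2 C by (intro mult_left_mono) auto
    ultimately show "exp (p * mgf_const * (24 * \<kappa>)\<^sup>2 - \<kappa> * r) \<le> exp ((mgf_const - C / 48) * l)"
      by (simp add: \<kappa>_def r_def algebra_simps)
  next
    let ?b = "sum_sixth_const B + 2 + B"
    have b: "0 \<le> ?b"
      using B_nonneg by (simp add: sum_sixth_const_def)
    have V: "V \<le> ?b * (8 / 9) ^ k"
    proof -
      have q1: "(3 / 4 :: real) ^ k \<le> (8 / 9) ^ k"
        by (intro power_mono) auto
      have q2: "(1 / 2 :: real) ^ k \<le> (8 / 9) ^ k"
        by (intro power_mono) auto
      have q3: "1 / ((3 / 4 :: real) ^ k)\<^sup>2 * (1 / 2) ^ k = (8 / 9) ^ k"
      proof -
        have "((3 / 4 :: real) ^ k)\<^sup>2 = (9 / 16) ^ k"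
          by (simp add: power2_eq_square power_mult_distrib[symmetric])
        then have "1 / ((3 / 4 :: real) ^ k)\<^sup>2 = (16 / 9) ^ k"
          by (simp add: power_one_over[symmetric])
        then show ?thesis
          by (simp add: power_mult_distrib[symmetric])
      qed
      have "(1 / ((3 / 4) ^ k)\<^sup>2 + 1) * ((2 + B) / real (2 * 2 ^ k)) =
          (2 + B) / 2 * (1 / ((3 / 4) ^ k)\<^sup>2 * (1 / 2) ^ k + (1 / 2) ^ k)"
        by (simp add: power_one_over field_simps)
      also have "\<dots> \<le> (2 + B) / 2 * ((8 / 9) ^ k + (8 / 9) ^ k)"
        unfolding q3 using q2 B_nonneg by (intro mult_left_mono) auto
      also have "\<dots> = (2 + B) * (8 / 9) ^ k"
        by (simp add: field_simps)
      finally have "(1 / ((3 / 4) ^ k)\<^sup>2 + 1) * ((2 + B) / real (2 * 2 ^ k)) \<le> (2 + B) * (8 / 9) ^ k" .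
      moreover have "(3 / 4) ^ k * sum_sixth_const B \<le> (8 / 9) ^ k * sum_sixth_const B"
        using q1 B_nonneg by (intro mult_right_mono) (auto simp: sum_sixth_const_def)
      ultimately show ?thesis
        unfolding V_def by (simp add: algebra_simps)
    qed
    \<comment> \<open>Since \<open>l \<ge> 1 / 2\<close>, the square root term of \<open>r\<close>
      alone is of order \<open>sqrt p\<close>, which cancels the \<open>p\<close> summands in
      Chebyshev's bound.\<close>
    have "C\<^sup>2 * p / 8 \<le> r\<^sup>2"
    proof -
      have "C\<^sup>2 * p / 8 \<le> C\<^sup>2 / 4 * (p * l)"
        using C p l by (simp add: field_simps)
      also have "\<dots> = (C / 2 * sqrt (p * l))\<^sup>2"
        using pl by (simp add: power_mult_distrib power_divide)
      also have "\<dots> \<le> r\<^sup>2"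
        using C p l unfolding r_def by (intro power_mono mult_left_mono) auto
      finally show ?thesis .
    qed
    then have "p * V / r\<^sup>2 \<le> p * (?b * (8 / 9) ^ k) / (C\<^sup>2 * p / 8)"
      using V p C r b by (intro frac_le mult_left_mono mult_nonneg_nonneg) auto
    also have "\<dots> = 8 * ?b * (8 / 9) ^ k / C\<^sup>2"
      using p by simp
    finally show "p * V / r\<^sup>2 \<le> 8 * ?b * (8 / 9) ^ k / C\<^sup>2" .
  qed
  finally show ?thesis .
qed

section \<open>The two testing errors\<close>

lemma dense_rate_ge:
  assumes "2 \<le> n"
  shows "sqrt (real p * ln (ln (8 * real n))) \<le> dense_rate p n"
    "1 / 2 \<le> dense_rate p n"
  using ln_ln_ge_half[OF assms] by (auto simp: dense_rate_def add_increasing)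

lemma sum_power_eight_ninths_le: "(\<Sum>k\<in>{0..N}. (8 / 9 :: real) ^ k) \<le> 9"
proof -
  have "(\<Sum>k\<in>{0..N}. (8 / 9 :: real) ^ k) = (\<Sum>k<Suc N. (8 / 9) ^ k)"
    by (intro sum.cong) auto
  also have "\<dots> = 9 * (1 - (8 / 9) ^ Suc N)"
    by (subst sum_gp_strict) simp
  also have "\<dots> \<le> 9"
    by simp
  finally show ?thesis .
qed

text \<open>A union bound over the exponents \<open>k\<close>. The exponential parts are multiplied
  by the number of scales, which puts \<open>1 +\<close> into the exponent; the Chebyshev parts form
  a geometric series with sum at most 9, and 72 = 8 * 9.\<close>

lemma type_I_error_le:
  assumes P: "P \<in> joint_noise_class \<alpha> K p n" and \<theta>: "\<theta> \<in> null_params p n"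
    and n: "2 \<le> n" and p: "1 \<le> p" and C: "0 < C"
    and B: "0 \<le> B" "\<And>D. D \<in> noise_class \<alpha> K \<Longrightarrow> integrable D (\<lambda>w. w ^ 6)"
      "\<And>D. D \<in> noise_class \<alpha> K \<Longrightarrow> (LINT w|D. w ^ 6) \<le> B"
  shows "(\<integral>\<^sup>+X. ennreal (dense_test p n (C * dense_rate p n) X) \<partial>data_law p n \<theta> P) \<le>
    ennreal (2 * exp ((1 + mgf_const - C / 48) * ln (ln (8 * real n))) + 72 * (sum_sixth_const B + 2 + B) / C\<^sup>2)"
proof -
  interpret prob_space P
    using P by (simp add: joint_noise_class_def)
  have sets_P [measurable_cong]: "sets P = sets (mat_space p n)"
    using P by (simp add: joint_noise_class_def)
  let ?l = "ln (ln (8 * real n))" and ?r = "C * dense_rate p n"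
  let ?N = "nat \<lfloor>log 2 (real n / 2)\<rfloor>" and ?b = "sum_sixth_const B + 2 + B"
  let ?A = "\<lambda>t. {E \<in> space P. ?r < A_stat p n (mat_add p n \<theta> E) t}"
  note [measurable] = measurable_mat_add measurable_dense_test[OF n]
  have measA: "?A t \<in> sets P" if "t \<in> dyadic_grid n" for t
    using measurable_A_stat[OF n that, of p] by measurable
  have bound: "prob (?A (2 ^ k)) \<le> exp ((mgf_const - C / 48) * ?l) + 8 * ?b * (8 / 9) ^ k / C\<^sup>2"
    if k: "k \<in> {0..?N}" for k
  proof -
    have "2 ^ k \<in> dyadic_grid n"
      using k by (simp add: dyadic_grid_def)
    then have tn: "2 * 2 ^ k \<le> n"
      by (rule dyadic_grid_bounds(2)[OF n])
    interpret std_indep_family P "\<lambda>i E. contrast_sign (2 ^ k) i * E i" "mat_index p n" B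
      by (rule joint_noise_std_indep_family[OF P B]) (auto simp: contrast_sign_def)
    show ?thesis
      unfolding A_stat_null[OF \<theta> tn] dense_rate_def
      by (rule prob_sum_block_excess_gt_rate)
        (use tn p C ln_ln_ge_half[OF n] in
          \<open>auto intro!: disjoint_contrast_block card_contrast_block contrast_block_subset[THEN subsetD]\<close>)
  qed
  have "(\<integral>\<^sup>+X. ennreal (dense_test p n ?r X) \<partial>data_law p n \<theta> P) =
      (\<integral>\<^sup>+E. ennreal (dense_test p n ?r (mat_add p n \<theta> E)) \<partial>P)"
    unfolding data_law_def by (intro nn_integral_distr) measurable
  also have "\<dots> = (\<integral>\<^sup>+E. indicator (\<Union>t\<in>dyadic_grid n. ?A t) E \<partial>P)"
    by (intro nn_integral_cong)
      (auto simp: dense_test_def indicator_def Max_gr_iff finite_dyadic_grid dyadic_grid_nonempty)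
  also have "\<dots> = ennreal (prob (\<Union>t\<in>dyadic_grid n. ?A t))"
    using measA finite_dyadic_grid by (subst nn_integral_indicator) (auto simp: emeasure_eq_measure)
  also have "(\<Union>t\<in>dyadic_grid n. ?A t) = (\<Union>k\<in>{0..?N}. ?A (2 ^ k))"
    by (auto simp: dyadic_grid_def)
  also have "prob \<dots> \<le> (\<Sum>k\<in>{0..?N}. prob (?A (2 ^ k)))"
    by (intro measure_UNION_le measA) (auto simp: dyadic_grid_def)
  also have "\<dots> \<le> (\<Sum>k\<in>{0..?N}. exp ((mgf_const - C / 48) * ?l) + 8 * ?b * (8 / 9) ^ k / C\<^sup>2)"
    by (intro sum_mono bound)
  also have "\<dots> = real (card {0..?N}) * exp ((mgf_const - C / 48) * ?l) +
      8 * ?b / C\<^sup>2 * (\<Sum>k\<in>{0..?N}. (8 / 9) ^ k)"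
    by (simp add: sum.distrib sum_distrib_left)
  also have "\<dots> \<le> 2 * exp ?l * exp ((mgf_const - C / 48) * ?l) + 8 * ?b / C\<^sup>2 * 9"
    using B(1) by (intro add_mono mult_right_mono mult_left_mono card_dyadic_exponents_le[OF n] sum_power_eight_ninths_le)
      (auto simp: sum_sixth_const_def)
  also have "\<dots> = 2 * exp ((1 + mgf_const - C / 48) * ?l) + 72 * ?b / C\<^sup>2"
    by (simp add: mult_exp_exp algebra_simps)
  finally show ?thesis
    by (simp add: ennreal_leI)
qed

text \<open>The maximum dominates the statistic at the scale of \<open>alt_shift_ge\<close>, whose
  shift \<open>D\<close> is at least \<open>C2 / 4\<close> times the rate. By
  \<open>8 * C1 \<le> C2\<close> the threshold is at most \<open>D / 2\<close>, so acceptance is a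
  deviation covered by \<open>prob_shifted_sum_le\<close>.\<close>

lemma type_II_error_le:
  assumes P: "P \<in> joint_noise_class \<alpha> K p n" and \<theta>: "\<theta> \<in> alt_params p n s \<rho>"
    and n: "2 \<le> n" and p: "1 \<le> p" and C1: "0 < C1" and C2: "1 \<le> C2" "8 * C1 \<le> C2"
    and \<rho>: "C2 * dense_rate p n \<le> \<rho>\<^sup>2"
    and B: "0 \<le> B" "\<And>D. D \<in> noise_class \<alpha> K \<Longrightarrow> integrable D (\<lambda>w. w ^ 6)"
      "\<And>D. D \<in> noise_class \<alpha> K \<Longrightarrow> (LINT w|D. w ^ 6) \<le> B"
  shows "(\<integral>\<^sup>+X. ennreal (1 - dense_test p n (C1 * dense_rate p n) X) \<partial>data_law p n \<theta> P) \<le>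
    ennreal (256 * (sum_sixth_const B + 3) / C2)"
proof -
  interpret prob_space P
    using P by (simp add: joint_noise_class_def)
  have sets_P [measurable_cong]: "sets P = sets (mat_space p n)"
    using P by (simp add: joint_noise_class_def)
  let ?l = "ln (ln (8 * real n))" and ?r = "C1 * dense_rate p n" and ?R = "dense_rate p n"
  note [measurable] = measurable_mat_add measurable_dense_test[OF n]
  obtain t where t: "t \<in> dyadic_grid n" and D4: "\<rho>\<^sup>2 / 4 \<le> (\<Sum>j\<in>{1..p}. (Y_stat n \<theta> t j)\<^sup>2)"
    by (rule alt_shift_ge[OF \<theta>])
  define D where "D = (\<Sum>j\<in>{1..p}. (Y_stat n \<theta> t j)\<^sup>2)"
  note tn = dyadic_grid_bounds[OF n t]
  have l: "1 / 2 \<le> ?l" by (rule ln_ln_ge_half[OF n])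
  note R = dense_rate_ge[OF n, of p]
  have DR: "C2 / 4 * ?R \<le> D"
    using D4 \<rho> by (simp add: D_def)
  have "C1 * ?R \<le> C2 / 8 * ?R"
    using C2 R(2) by (intro mult_right_mono) auto
  then have Dr: "?r \<le> D / 2"
    using DR by linarith
  have D1: "C2 / 8 \<le> D"
    using mult_left_mono[OF R(2), of "C2 / 4"] DR C2 by linarith
  then have Dpos: "0 < D"
    using C2 by linarith
  \<comment> \<open>The square root part of the rate together with \<open>?l \<ge> 1 / 2\<close>
    makes \<open>D\<^sup>2\<close> comparable to \<open>p\<close>, so the noise variance,
    proportional to \<open>p\<close>, is absorbed uniformly in \<open>p\<close>.\<close>
  have D2: "C2\<^sup>2 * p / 32 \<le> D\<^sup>2"
  proof -
    have "C2\<^sup>2 * p / 32 \<le> C2\<^sup>2 / 16 * (real p * ?l)"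
      using l C2 p by (simp add: field_simps)
    also have "\<dots> = (C2 / 4 * sqrt (real p * ?l))\<^sup>2"
      using l p by (simp add: power_mult_distrib power_divide)
    also have "\<dots> \<le> D\<^sup>2"
    proof (intro power_mono)
      have "C2 / 4 * sqrt (real p * ?l) \<le> C2 / 4 * ?R"
        using R(1) C2 by (intro mult_left_mono) auto
      then show "C2 / 4 * sqrt (real p * ?l) \<le> D"
        using DR by linarith
    qed (use C2 l in auto)
    finally show ?thesis .
  qed
  interpret std_indep_family P "\<lambda>i E. contrast_sign t i * E i" "mat_index p n" B
    by (rule joint_noise_std_indep_family[OF P B]) (auto simp: contrast_sign_def)
  let ?v = "sum_sixth_const B + 2"
  have v: "0 \<le> ?v"
    using B(1) by (simp add: sum_sixth_const_def)
  let ?A = "{E \<in> space P. A_stat p n (mat_add p n \<theta> E) t \<le> D / 2}"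
  have measA: "?A \<in> sets P"
    using measurable_A_stat[OF n t, of p] by measurable
  have "prob ?A \<le> 4 * (2 * real (card {1..p}) * ?v + 8 * D) / D\<^sup>2"
    unfolding A_stat_mat_add[OF tn(2)] D_def
    by (rule prob_shifted_sum_le)
      (use tn Dpos in \<open>auto simp: D_def intro!: disjoint_contrast_block card_contrast_block contrast_block_subset[THEN subsetD]\<close>)
  also have "\<dots> = 8 * ?v * real p / D\<^sup>2 + 32 / D"
    using Dpos by (simp add: field_simps power2_eq_square)
  also have "\<dots> \<le> 8 * ?v * real p / (C2\<^sup>2 * p / 32) + 32 / (C2 / 8)"
    using D1 D2 C2 p v Dpos by (intro add_mono divide_left_mono) auto
  also have "\<dots> = 256 * ?v / C2\<^sup>2 + 256 / C2"
    using p by simp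
  also have "\<dots> \<le> 256 * ?v / C2 + 256 / C2"
    using C2 v by (intro add_right_mono divide_left_mono) (auto simp: power2_eq_square)
  also have "\<dots> = 256 * (sum_sixth_const B + 3) / C2"
    by (simp add: add_divide_distrib[symmetric])
  finally have bound: "prob ?A \<le> 256 * (sum_sixth_const B + 3) / C2" .
  have "(\<integral>\<^sup>+X. ennreal (1 - dense_test p n ?r X) \<partial>data_law p n \<theta> P) =
      (\<integral>\<^sup>+E. ennreal (1 - dense_test p n ?r (mat_add p n \<theta> E)) \<partial>P)"
    unfolding data_law_def by (intro nn_integral_distr) measurable
  also have "\<dots> \<le> (\<integral>\<^sup>+E. indicator ?A E \<partial>P)"
  proof (intro nn_integral_mono)
    fix E assume "E \<in> space P"
    moreover have "dense_test p n ?r (mat_add p n \<theta> E) = 1"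
      if "\<not> A_stat p n (mat_add p n \<theta> E) t \<le> D / 2"
      using t Dr that
      by (auto simp: dense_test_def Max_gr_iff finite_dyadic_grid dyadic_grid_nonempty intro!: bexI[of _ t])
    ultimately show "ennreal (1 - dense_test p n ?r (mat_add p n \<theta> E)) \<le> indicator ?A E"
      by (auto simp: indicator_def) (simp add: dense_test_def)
  qed
  also have "\<dots> = ennreal (prob ?A)"
    using measA by (simp add: emeasure_eq_measure)
  finally show ?thesis
    using bound by (meson ennreal_leI order_trans)
qed

theorem theorem1:
  fixes \<alpha> K \<epsilon> :: real
  assumes "0 < \<alpha>" and "\<alpha> \<le> 2" and "0 < K" and "0 < \<epsilon>" and "\<epsilon> < 1"
  shows "\<exists>C\<^sub>1>0. \<exists>C\<^sub>2>0. \<forall>(n::nat)\<ge>2. \<forall>(p::nat)\<ge>1. \<forall>s\<in>{1..p}. \<forall>\<rho>::real.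
           \<rho>\<^sup>2 \<ge> C\<^sub>2 * dense_rate p n \<longrightarrow>
           worst_case_error \<alpha> K p n s \<rho> (dense_test p n (C\<^sub>1 * dense_rate p n)) \<le> ennreal \<epsilon>"
proof -
  obtain B where B: "0 \<le> B" "\<And>D. D \<in> noise_class \<alpha> K \<Longrightarrow> integrable D (\<lambda>w. w ^ 6)"
      "\<And>D. D \<in> noise_class \<alpha> K \<Longrightarrow> (LINT w|D. w ^ 6) \<le> B"
    using noise_class_sixth_moment[OF assms(1,3)] by blast
  define b where "b = sum_sixth_const B + 2 + B"
  \<comment> \<open>Each of the two type I terms gets \<open>\<epsilon> / 4\<close>: 16 serves
    \<open>2 * exp (- (q / 2)) \<le> 4 / q\<close>, and 288 = 4 * 72 serves the Chebyshev
    term.\<close>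
  define q where "q = (16 + 288 * b) / \<epsilon>"
  \<comment> \<open>Makes the exponent \<open>1 + mgf_const - C1 / 48\<close> equal to
    \<open>- q\<close>, so the factor from counting scales is beaten as well.\<close>
  define C1 where "C1 = 48 * (1 + mgf_const + q)"
  \<comment> \<open>The summands secure in turn \<open>1 \<le> C2\<close>,
    \<open>8 * C1 \<le> C2\<close>, and a type II error of at most \<open>\<epsilon> / 2\<close>,
    with 512 = 2 * 256.\<close>
  define C2 where "C2 = 1 + 8 * C1 + 512 * (sum_sixth_const B + 3) / \<epsilon>"
  have s0: "0 \<le> sum_sixth_const B" and b: "0 \<le> b"
    using B(1) by (auto simp: b_def sum_sixth_const_def)
  have q: "0 < q" "16 / \<epsilon> \<le> q" "288 * b / \<epsilon> \<le> q"
    using assms b by (auto simp: q_def divide_right_mono intro!: divide_pos_pos)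
  have C1: "1 \<le> C1" "q \<le> C1"
    using q by (auto simp: C1_def mgf_const_def add_nonneg_nonneg)
  have C2: "1 \<le> C2" "8 * C1 \<le> C2" "512 * (sum_sixth_const B + 3) / \<epsilon> \<le> C2"
    using C1 s0 assms by (auto simp: C2_def)
  have "worst_case_error \<alpha> K p n s \<rho> (dense_test p n (C1 * dense_rate p n)) \<le> ennreal \<epsilon>"
    if n: "2 \<le> n" and p: "1 \<le> p" and \<rho>: "C2 * dense_rate p n \<le> \<rho>\<^sup>2" for n p s :: nat and \<rho> :: real
  proof -
    have I: "(\<integral>\<^sup>+X. ennreal (dense_test p n (C1 * dense_rate p n) X) \<partial>data_law p n \<theta> P) \<le> ennreal (\<epsilon> / 2)"
      if "P \<in> joint_noise_class \<alpha> K p n" "\<theta> \<in> null_params p n" for P \<theta>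
    proof -
      let ?l = "ln (ln (8 * real n))"
      have "(1 + mgf_const - C1 / 48) * ?l = - (q * ?l)"
        by (simp add: C1_def algebra_simps)
      also have "\<dots> \<le> - (q / 2)"
        using mult_left_mono[OF ln_ln_ge_half[OF n], of q] q by simp
      finally have "exp ((1 + mgf_const - C1 / 48) * ?l) \<le> exp (- (q / 2))"
        by simp
      also have "\<dots> \<le> 1 / (q / 2)"
        using exp_ge_add_one_self[of "q / 2"] q by (simp add: exp_minus field_simps)
      also have "\<dots> \<le> 1 / (16 / \<epsilon> / 2)"
        using q assms by (intro divide_left_mono) auto
      finally have 1: "2 * exp ((1 + mgf_const - C1 / 48) * ?l) \<le> \<epsilon> / 4"
        by simp
      have "288 * b / \<epsilon> \<le> C1"
        using C1 q by linarith
      then have C1': "288 * b \<le> C1 * \<epsilon>"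
        using assms by (simp add: pos_divide_le_eq)
      have "72 * b / C1\<^sup>2 \<le> 72 * b / C1"
        using C1 b by (intro divide_left_mono) (auto simp: power2_eq_square)
      also have "\<dots> \<le> \<epsilon> / 4"
        using C1' C1 by (simp add: field_simps)
      finally have 2: "72 * b / C1\<^sup>2 \<le> \<epsilon> / 4" .
      have "(\<integral>\<^sup>+X. ennreal (dense_test p n (C1 * dense_rate p n) X) \<partial>data_law p n \<theta> P) \<le>
          ennreal (2 * exp ((1 + mgf_const - C1 / 48) * ?l) + 72 * b / C1\<^sup>2)"
        unfolding b_def using that n p C1 B by (intro type_I_error_le) auto
      also have "\<dots> \<le> ennreal (\<epsilon> / 2)"
        using 1 2 by (intro ennreal_leI) linarith
      finally show ?thesis .
    qed
    have II: "(\<integral>\<^sup>+X. ennreal (1 - dense_test p n (C1 * dense_rate p n) X) \<partial>data_law p n \<theta> P) \<le> ennreal (\<epsilon> / 2)"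
      if "P \<in> joint_noise_class \<alpha> K p n" "\<theta> \<in> alt_params p n s \<rho>" for P \<theta>
    proof -
      have "(\<integral>\<^sup>+X. ennreal (1 - dense_test p n (C1 * dense_rate p n) X) \<partial>data_law p n \<theta> P) \<le>
          ennreal (256 * (sum_sixth_const B + 3) / C2)"
        by (rule type_II_error_le[OF that n p _ C2(1,2) \<rho> B]) (use C1 in auto)
      also have "256 * (sum_sixth_const B + 3) / C2 \<le> \<epsilon> / 2"
        using C2 assms by (simp add: field_simps)
      finally show ?thesis
        by (simp add: ennreal_leI)
    qed
    have "worst_case_error \<alpha> K p n s \<rho> (dense_test p n (C1 * dense_rate p n)) \<le>
        ennreal (\<epsilon> / 2) + ennreal (\<epsilon> / 2)"
      unfolding worst_case_error_def by (intro add_mono SUP_least I II)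
    also have "\<dots> = ennreal \<epsilon>"
      using assms by (subst ennreal_plus[symmetric]) auto
    finally show ?thesis .
  qed
  then show ?thesis
    using C1 C2 by (intro exI[of _ C1] exI[of _ C2] conjI) auto
qed

end
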